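(* Let $\Sigma$ be a finite set and $k\ge 0$, and let $\Phi_1,\Phi_2$ be patterns for the class $\mathsf E_k\Sigma$. If $\Phi_1$ and $\Phi_2$ are not isomorphic, then the functions they define are not equivalent, i.e.\ there is an input tree $t\in\mathsf E_k\Sigma$ such that the output trees $\Phi_1(t)$ and $\Phi_2(t)$ are not isomorphic.
   Context: $\mathsf E_k\Sigma$ is the class of finite unordered trees of height at most $k$ with edges labelled by $\Sigma$, in the edge representation: universe = edges, unary relations for labels, and a parent function mapping each edge to its parent edge (looping on edges from the root). Induced substructures are subsets of edges closed under the parent function (pruned trees; the empty structure represents the root-only tree); an embedding is an injective map on edges preserving labels and the parent function. A pattern for $\mathsf E_k\Sigma$ is a finite rooted tree $\Phi$ with each node $x$ labelled by $\Phi(x)\in\mathsf E_k\Sigma$, the root labelled by the empty structure, and $\Phi(x)$ an induced substructure of $\Phi(y)$ whenever $x$ is the parent of $y$. The function defined by $\Phi$ maps $t$ to the unlabelled tree whose nodes are pairs $(x,\alpha)$ with $\alpha:\Phi(x)\hookrightarrow t$ an embedding, with children of $(x,\alpha)$ being the $(y,\beta)$ such that $y$ is a child of $x$ and $\beta$ extends $\alpha$. Two patterns are isomorphic if there is a bijection between their underlying trees preserving the tree structure, together with a family of isomorphisms, one for each node $x$ of the first pattern, from its label to the label of the corresponding node of the second pattern, such that the isomorphism for a node extends the isomorphism for its parent. *)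

theory Defs
  imports "HOL-Library.FuncSet"
begin

section \<open>Edge-labelled trees in the edge representation\<close>

text \<open>The unary relation of a label \<open>a\<close> is \<open>{e \<in> edges t. lab t e = a}\<close>. The functions \<open>lab\<close> and
  \<open>par\<close> are only meaningful on \<open>edges\<close>.\<close>

record ('e, 's) etree =
  edges :: "'e set"
  lab :: "'e \<Rightarrow> 's"
  par :: "'e \<Rightarrow> 'e"

text \<open>An edge at distance \<open>n\<close> from an edge leaving the root ends at depth \<open>n + 1\<close>, so the height is at
  most \<open>k\<close> iff the parent function reaches a loop in fewer than \<open>k\<close> steps from every edge. This also
  excludes cycles other than the loops at the edges leaving the root.\<close>

definition etrees :: "nat \<Rightarrow> 's set \<Rightarrow> ('e, 's) etree set" where
  "etrees k \<Sigma> = {t. finite (edges t) \<and> lab t ` edges t \<subseteq> \<Sigma> \<and> par t ` edges t \<subseteq> edges t \<and>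
     (\<forall>e\<in>edges t. \<exists>n<k. par t ((par t ^^ n) e) = (par t ^^ n) e)}"

definition induced_substructure :: "('e, 's) etree \<Rightarrow> ('e, 's) etree \<Rightarrow> bool" where
  "induced_substructure A B \<longleftrightarrow> edges A \<subseteq> edges B \<and> par B ` edges A \<subseteq> edges A \<and>
     (\<forall>e\<in>edges A. lab A e = lab B e \<and> par A e = par B e)"

definition embedding :: "('e, 's) etree \<Rightarrow> ('f, 's) etree \<Rightarrow> ('e \<Rightarrow> 'f) \<Rightarrow> bool" where
  "embedding A B f \<longleftrightarrow> inj_on f (edges A) \<and> f ` edges A \<subseteq> edges B \<and>
     (\<forall>e\<in>edges A. lab B (f e) = lab A e \<and> par B (f e) = f (par A e))"

definition etree_isomorphism :: "('e, 's) etree \<Rightarrow> ('f, 's) etree \<Rightarrow> ('e \<Rightarrow> 'f) \<Rightarrow> bool" where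
  "etree_isomorphism A B f \<longleftrightarrow> bij_betw f (edges A) (edges B) \<and>
     (\<forall>e\<in>edges A. lab B (f e) = lab A e \<and> par B (f e) = f (par A e))"

text \<open>Restricting to \<open>extensional\<close> functions makes each embedding a unique HOL function.\<close>

definition embeddings :: "('e, 's) etree \<Rightarrow> ('f, 's) etree \<Rightarrow> ('e \<Rightarrow> 'f) set" where
  "embeddings A B = {f \<in> extensional (edges A). embedding A B f}"


section \<open>Unlabelled rooted trees\<close>

text \<open>\<open>(x, y) \<in> arcs T\<close> means that \<open>x\<close> is the parent of \<open>y\<close>.\<close>

record 'x rtree =
  nodes :: "'x set"
  root :: 'x
  arcs :: "('x \<times> 'x) set"

definition finite_rooted_tree :: "('x, 'm) rtree_scheme \<Rightarrow> bool" where
  "finite_rooted_tree T \<longleftrightarrow> finite (nodes T) \<and> root T \<in> nodes T \<and> arcs T \<subseteq> nodes T \<times> nodes T \<and>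
     (\<forall>x. (x, root T) \<notin> arcs T) \<and>
     (\<forall>y\<in>nodes T - {root T}. \<exists>!x. (x, y) \<in> arcs T) \<and>
     (\<forall>y\<in>nodes T. (root T, y) \<in> (arcs T)\<^sup>*)"

definition rtree_isomorphism :: "('x, 'm) rtree_scheme \<Rightarrow> ('y, 'n) rtree_scheme \<Rightarrow> ('x \<Rightarrow> 'y) \<Rightarrow> bool" where
  "rtree_isomorphism T U g \<longleftrightarrow> bij_betw g (nodes T) (nodes U) \<and> g (root T) = root U \<and>
     (\<forall>x\<in>nodes T. \<forall>y\<in>nodes T. (x, y) \<in> arcs T \<longleftrightarrow> (g x, g y) \<in> arcs U)"

definition rtree_isomorphic :: "('x, 'm) rtree_scheme \<Rightarrow> ('y, 'n) rtree_scheme \<Rightarrow> bool" where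
  "rtree_isomorphic T U \<longleftrightarrow> (\<exists>g. rtree_isomorphism T U g)"


section \<open>Patterns\<close>

record ('x, 'e, 's) pattern = "'x rtree" +
  label :: "'x \<Rightarrow> ('e, 's) etree"

definition patterns :: "nat \<Rightarrow> 's set \<Rightarrow> ('x, 'e, 's) pattern set" where
  "patterns k \<Sigma> = {\<Phi>. finite_rooted_tree \<Phi> \<and>
     (\<forall>x\<in>nodes \<Phi>. label \<Phi> x \<in> etrees k \<Sigma>) \<and>
     edges (label \<Phi> (root \<Phi>)) = {} \<and>
     (\<forall>(x, y)\<in>arcs \<Phi>. induced_substructure (label \<Phi> x) (label \<Phi> y))}"

definition pattern_isomorphic :: "('x, 'e, 's) pattern \<Rightarrow> ('y, 'f, 's) pattern \<Rightarrow> bool" where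
  "pattern_isomorphic \<Phi> \<Psi> \<longleftrightarrow>
     (\<exists>g h. rtree_isomorphism \<Phi> \<Psi> g \<and>
        (\<forall>x\<in>nodes \<Phi>. etree_isomorphism (label \<Phi> x) (label \<Psi> (g x)) (h x)) \<and>
        (\<forall>(x, y)\<in>arcs \<Phi>. \<forall>e\<in>edges (label \<Phi> x). h y e = h x e))"

text \<open>In the root of the output, \<open>\<lambda>_. undefined\<close> is the unique extensional embedding of the empty
  structure.\<close>

definition pattern_fun :: "('x, 'e, 's) pattern \<Rightarrow> ('f, 's) etree \<Rightarrow> ('x \<times> ('e \<Rightarrow> 'f)) rtree" where
  "pattern_fun \<Phi> t =
     \<lparr>nodes = {(x, \<alpha>). x \<in> nodes \<Phi> \<and> \<alpha> \<in> embeddings (label \<Phi> x) t},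
      root = (root \<Phi>, \<lambda>_. undefined),
      arcs = {((x, \<alpha>), (y, \<beta>)). (x, y) \<in> arcs \<Phi> \<and>
        \<alpha> \<in> embeddings (label \<Phi> x) t \<and> \<beta> \<in> embeddings (label \<Phi> y) t \<and>
        (\<forall>e\<in>edges (label \<Phi> x). \<beta> e = \<alpha> e)}\<rparr>"

lemma induced_substructure_embedding:
  assumes "induced_substructure A B" "\<beta> \<in> embeddings B t"
  shows "restrict \<beta> (edges A) \<in> embeddings A t"
proof -
  have sub: "edges A \<subseteq> edges B" and "par B ` edges A \<subseteq> edges A"
    and eq: "\<And>e. e \<in> edges A \<Longrightarrow> lab A e = lab B e \<and> par A e = par B e"
    and \<beta>: "embedding B t \<beta>"
    using assms by (auto simp: induced_substructure_def embeddings_def)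
  then have "e \<in> edges B \<and> par A e \<in> edges A" if "e \<in> edges A" for e
    using that by fastforce
  moreover have "inj_on \<beta> (edges A)"
    using \<beta> sub by (auto simp: embedding_def intro: inj_on_subset)
  ultimately have "embedding A t (restrict \<beta> (edges A))"
    using \<beta> eq sub by (simp add: embedding_def image_subset_iff)
  then show ?thesis by (simp add: embeddings_def)
qed

lemma finite_embeddings:
  assumes "finite (edges A)" "finite (edges B)"
  shows "finite (embeddings A B)"
proof (rule finite_subset)
  show "embeddings A B \<subseteq> edges A \<rightarrow>\<^sub>E edges B"
    by (auto simp: embeddings_def embedding_def PiE_def)
  show "finite (edges A \<rightarrow>\<^sub>E edges B)"
    using assms by (intro finite_PiE) auto
qed

lemma finite_rooted_tree_pattern_fun:
  assumes \<Phi>: "\<Phi> \<in> patterns k \<Sigma>" and t: "t \<in> etrees k \<Sigma>"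
  shows "finite_rooted_tree (pattern_fun \<Phi> t)"
proof -
  let ?T = "pattern_fun \<Phi> t"
  from \<Phi> have tree: "finite_rooted_tree \<Phi>" and empty: "edges (label \<Phi> (root \<Phi>)) = {}"
    and sub: "\<And>x y. (x, y) \<in> arcs \<Phi> \<Longrightarrow> induced_substructure (label \<Phi> x) (label \<Phi> y)"
    and labels: "\<And>x. x \<in> nodes \<Phi> \<Longrightarrow> label \<Phi> x \<in> etrees k \<Sigma>"
    unfolding patterns_def by blast+
  have fin: "finite (embeddings (label \<Phi> x) t)" if "x \<in> nodes \<Phi>" for x
    using labels[OF that] t by (intro finite_embeddings) (simp_all add: etrees_def)
  have root_emb: "\<alpha> \<in> embeddings (label \<Phi> (root \<Phi>)) t \<longleftrightarrow> \<alpha> = (\<lambda>_. undefined)" for \<alpha>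
    by (auto simp: embeddings_def embedding_def empty extensional_def)
  have nodes_eq: "nodes ?T = Sigma (nodes \<Phi>) (\<lambda>x. embeddings (label \<Phi> x) t)"
    by (auto simp: pattern_fun_def)
  have parent: "((x, restrict \<beta> (edges (label \<Phi> x))), (y, \<beta>)) \<in> arcs ?T"
    if "(x, y) \<in> arcs \<Phi>" "\<beta> \<in> embeddings (label \<Phi> y) t" for x y \<beta>
    using that induced_substructure_embedding[OF sub] by (auto simp: pattern_fun_def)
  have parent_unique: "\<alpha> = restrict \<beta> (edges (label \<Phi> x))"
    if "((x, \<alpha>), (y, \<beta>)) \<in> arcs ?T" for x y \<alpha> \<beta>
    using that by (auto simp: pattern_fun_def embeddings_def extensional_def fun_eq_iff)
  have ex1: "\<exists>!p. (p, q) \<in> arcs ?T" if q_in: "q \<in> nodes ?T - {root ?T}" for q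
  proof -
    obtain y \<beta> where q: "q = (y, \<beta>)" "y \<in> nodes \<Phi>" "\<beta> \<in> embeddings (label \<Phi> y) t"
      using q_in by (auto simp: nodes_eq)
    have "y \<noteq> root \<Phi>"
      using q_in q root_emb by (auto simp: pattern_fun_def)
    then have "\<exists>!x. (x, y) \<in> arcs \<Phi>"
      using tree q(2) by (simp add: finite_rooted_tree_def)
    then obtain x where x: "(x, y) \<in> arcs \<Phi>" "\<And>x'. (x', y) \<in> arcs \<Phi> \<Longrightarrow> x' = x"
      by (auto elim: ex1E)
    show ?thesis
    proof (rule ex1I)
      show "((x, restrict \<beta> (edges (label \<Phi> x))), q) \<in> arcs ?T"
        using parent[OF x(1) q(3)] q(1) by simp
      show "p = (x, restrict \<beta> (edges (label \<Phi> x)))" if "(p, q) \<in> arcs ?T" for p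
      proof (cases p)
        case (Pair x' \<alpha>)
        then have "x' = x"
          using that q x(2) by (auto simp: pattern_fun_def)
        then show ?thesis
          using parent_unique[of x \<alpha> y \<beta>] that Pair q(1) by simp
      qed
    qed
  qed
  have reach: "(root ?T, (y, \<beta>)) \<in> (arcs ?T)\<^sup>*"
    if "(root \<Phi>, y) \<in> (arcs \<Phi>)\<^sup>*" "\<beta> \<in> embeddings (label \<Phi> y) t" for y \<beta>
    using that
  proof (induction arbitrary: \<beta> rule: rtrancl_induct)
    case base
    then show ?case by (simp add: root_emb pattern_fun_def)
  next
    case (step x y)
    show ?case
      using step.IH[OF induced_substructure_embedding[OF sub[OF step.hyps(2)] step.prems]]
        parent[OF step.hyps(2) step.prems] by (rule rtrancl_into_rtrancl)
  qed
  have "finite (nodes ?T)"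
    unfolding nodes_eq using tree fin by (auto simp: finite_rooted_tree_def)
  moreover have "root ?T \<in> nodes ?T" "arcs ?T \<subseteq> nodes ?T \<times> nodes ?T"
    "\<forall>p. (p, root ?T) \<notin> arcs ?T"
    using tree by (auto simp: pattern_fun_def root_emb finite_rooted_tree_def)
  moreover have "\<forall>q\<in>nodes ?T. (root ?T, q) \<in> (arcs ?T)\<^sup>*"
    using tree reach by (auto simp: nodes_eq finite_rooted_tree_def)
  ultimately show ?thesis
    using ex1 by (simp add: finite_rooted_tree_def)
qed

end

(* Hom-counts hom(S, -) from finite rooted trees S distinguish the outputs. In the output of a pattern,
   the count below a node (x, \<alpha>) is a product over the children s of S of sums, over the children y of x
   and the embeddings \<beta> extending \<alpha>, of the counts of s below (y, \<beta>); it is thus multiplicative in S.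
   Call two pattern nodes equivalent along an isomorphism of their labels if all these counts agree
   on all inputs. The point is that the children of equivalent nodes can be matched by equivalences,
   so that a pattern isomorphism is built from the root downwards.

   For the matching, cancel matched children. If some are left, let B be a smallest label among them,
   and evaluate the remaining identity on blow-ups of a tree U that contains B, and in which every edge
   e is replaced by n e copies. Grouped by projection to U, the counts become polynomials in n, and as
   functions of S they are characters with values in an integral domain. By linear independence of
   characters the weights of the characters equal to that of B cancel. At the multiplicities n for
   which the blow-up is just B, minimality of B leaves only isomorphic labels, and U was chosen so that
   inequivalent ones have different characters. Hence all the weights left have the same sign. *)

theory Submission imports "HOL-Computational_Algebra.Polynomial" Defs begin

text \<open>Inputs that isolate \<open>B\<close> and inputs that separate it from inequivalent nodes
  are different inputs. In a blow-up that is a copy of \<open>B\<close>, only isomorphisms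
  contribute, but the counts of inequivalent nodes may agree there. In a richer blow-up they differ,
  but many other embeddings contribute. Polynomials join the two: on a curve of multiplicities
  through both points, the characters differ as polynomials because they differ at the second point,
  while the weights are read off at the first. Linear independence also demands values without zero
  divisors, and integer functions on all multiplicity vectors have zero divisors; restriction to one
  curve gives the domain \<open>int poly\<close>. One tree \<open>U\<close> serves all separating
  inputs because these are finitely many, are glued along \<open>B\<close>, and a product of nonzero
  polynomials is nonzero.

  Equivalence is along a given isomorphism because a pattern isomorphism must be coherent between
  parent and child: children are compared with the embedding of the parent's label held
  fixed.\<close>

section \<open>Embeddings and isomorphisms of edge-labelled trees\<close>

lemma etreesD:
  assumes "t \<in> etrees k \<Sigma>"
  shows "finite (edges t)" "lab t ` edges t \<subseteq> \<Sigma>" "par t ` edges t \<subseteq> edges t"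
    "e \<in> edges t \<Longrightarrow> par t e \<in> edges t"
    "e \<in> edges t \<Longrightarrow> \<exists>n<k. par t ((par t ^^ n) e) = (par t ^^ n) e"
  using assms by (auto simp: etrees_def)

lemma embedding_cong:
  assumes "\<And>e. e \<in> edges A \<Longrightarrow> f e = g e" "par A ` edges A \<subseteq> edges A"
  shows "embedding A B f \<longleftrightarrow> embedding A B g"
proof -
  have "inj_on f (edges A) \<longleftrightarrow> inj_on g (edges A)"
    using assms(1) by (rule inj_on_cong)
  moreover have "f ` edges A = g ` edges A"
    using assms(1) by (rule image_cong[OF refl])
  ultimately show ?thesis
    using assms by (auto simp: embedding_def image_subset_iff)
qed

lemma embedding_comp:
  assumes "embedding A B f" "embedding B C g" "par A ` edges A \<subseteq> edges A"
  shows "embedding A C (g \<circ> f)"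
  using assms by (auto simp: embedding_def image_subset_iff inj_on_def)

lemma restrict_in_embeddings:
  assumes "embedding A B f" "par A ` edges A \<subseteq> edges A"
  shows "restrict f (edges A) \<in> embeddings A B"
  using assms embedding_cong[of A "restrict f (edges A)" f B]
  by (auto simp: embeddings_def)

lemma embeddingsD:
  assumes "f \<in> embeddings A B"
  shows "embedding A B f" "f \<in> extensional (edges A)" "inj_on f (edges A)"
    "e \<in> edges A \<Longrightarrow> f e \<in> edges B" "e \<in> edges A \<Longrightarrow> lab B (f e) = lab A e"
    "e \<in> edges A \<Longrightarrow> par B (f e) = f (par A e)"
  using assms by (auto simp: embeddings_def embedding_def)

lemma etree_isomorphism_embedding: "etree_isomorphism A B f \<Longrightarrow> embedding A B f"
  by (auto simp: etree_isomorphism_def embedding_def bij_betw_def)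

lemma etree_isomorphism_inv:
  assumes "etree_isomorphism A B f" "par A ` edges A \<subseteq> edges A"
  shows "etree_isomorphism B A (inv_into (edges A) f)"
  unfolding etree_isomorphism_def
proof (intro conjI ballI)
  let ?g = "inv_into (edges A) f"
  have bij: "bij_betw f (edges A) (edges B)" using assms by (simp add: etree_isomorphism_def)
  then show "bij_betw ?g (edges B) (edges A)" by (rule bij_betw_inv_into)
  fix e assume e: "e \<in> edges B"
  then have ge: "?g e \<in> edges A" "f (?g e) = e"
    using bij by (auto simp: bij_betw_def inv_into_into f_inv_into_f)
  with assms show "lab A (?g e) = lab B e" by (metis etree_isomorphism_def)
  have "f (par A (?g e)) = par B e" using ge assms by (metis etree_isomorphism_def)
  then show "par A (?g e) = ?g (par B e)"
    using bij ge(1) assms(2) by (metis bij_betw_def image_subset_iff inv_into_f_f)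
qed

lemma etree_isomorphism_closed:
  assumes "etree_isomorphism A B f" "par A ` edges A \<subseteq> edges A"
  shows "par B ` edges B \<subseteq> edges B"
proof
  fix u assume "u \<in> par B ` edges B"
  moreover have "edges B = f ` edges A"
    using assms(1) by (simp add: etree_isomorphism_def bij_betw_def)
  ultimately obtain e where "e \<in> edges A" "u = par B (f e)" by auto
  then show "u \<in> edges B"
    using assms by (auto simp: etree_isomorphism_def bij_betw_def image_subset_iff)
qed

lemma bij_betw_embeddings_target:
  assumes iso: "etree_isomorphism t t' \<phi>" and t: "par t ` edges t \<subseteq> edges t"
    and A: "par A ` edges A \<subseteq> edges A"
  shows "bij_betw (\<lambda>\<beta>. restrict (\<phi> \<circ> \<beta>) (edges A)) (embeddings A t) (embeddings A t')"
proof (rule bij_betw_byWitness[where f' = "\<lambda>\<beta>. restrict (inv_into (edges t) \<phi> \<circ> \<beta>) (edges A)"])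
  have bij: "bij_betw \<phi> (edges t) (edges t')" using iso by (simp add: etree_isomorphism_def)
  show "\<forall>\<beta>\<in>embeddings A t. restrict (inv_into (edges t) \<phi> \<circ> restrict (\<phi> \<circ> \<beta>) (edges A)) (edges A) = \<beta>"
    using bij by (auto simp: bij_betw_def inv_into_f_f embeddingsD(4)
      intro!: extensionalityI[where A = "edges A"] dest: embeddingsD(2))
  show "\<forall>\<beta>\<in>embeddings A t'. restrict (\<phi> \<circ> restrict (inv_into (edges t) \<phi> \<circ> \<beta>) (edges A)) (edges A) = \<beta>"
    using bij by (auto simp: bij_betw_def f_inv_into_f embeddingsD(4)
      intro!: extensionalityI[where A = "edges A"] dest: embeddingsD(2))
  show "(\<lambda>\<beta>. restrict (\<phi> \<circ> \<beta>) (edges A)) ` embeddings A t \<subseteq> embeddings A t'"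
    using embedding_comp[OF _ etree_isomorphism_embedding[OF iso] A]
    by (auto intro!: restrict_in_embeddings A dest: embeddingsD(1))
  show "(\<lambda>\<beta>. restrict (inv_into (edges t) \<phi> \<circ> \<beta>) (edges A)) ` embeddings A t' \<subseteq> embeddings A t"
    using embedding_comp[OF _ etree_isomorphism_embedding[OF etree_isomorphism_inv[OF iso t]] A]
    by (auto intro!: restrict_in_embeddings A dest: embeddingsD(1))
qed

lemma bij_betw_embeddings_source:
  assumes iso: "etree_isomorphism A B \<sigma>" and A: "par A ` edges A \<subseteq> edges A"
  shows "bij_betw (\<lambda>\<beta>. restrict (\<beta> \<circ> \<sigma>) (edges A)) (embeddings B t) (embeddings A t)"
proof (rule bij_betw_byWitness[where f' = "\<lambda>\<beta>. restrict (\<beta> \<circ> inv_into (edges A) \<sigma>) (edges B)"])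
  have bij: "bij_betw \<sigma> (edges A) (edges B)" using iso by (simp add: etree_isomorphism_def)
  have B: "par B ` edges B \<subseteq> edges B" using etree_isomorphism_closed[OF iso A] .
  show "\<forall>\<beta>\<in>embeddings B t. restrict (restrict (\<beta> \<circ> \<sigma>) (edges A) \<circ> inv_into (edges A) \<sigma>) (edges B) = \<beta>"
    using bij by (auto simp: bij_betw_def f_inv_into_f inv_into_into embeddingsD(4)
      intro!: extensionalityI[where A = "edges B"] dest: embeddingsD(2))
  show "\<forall>\<beta>\<in>embeddings A t. restrict (restrict (\<beta> \<circ> inv_into (edges A) \<sigma>) (edges B) \<circ> \<sigma>) (edges A) = \<beta>"
    using bij by (auto simp: bij_betw_def inv_into_f_f embeddingsD(4)
      intro!: extensionalityI[where A = "edges A"] dest: embeddingsD(2))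
  show "(\<lambda>\<beta>. restrict (\<beta> \<circ> \<sigma>) (edges A)) ` embeddings B t \<subseteq> embeddings A t"
    using embedding_comp[OF etree_isomorphism_embedding[OF iso] _ A]
    by (auto intro!: restrict_in_embeddings A dest: embeddingsD(1))
  show "(\<lambda>\<beta>. restrict (\<beta> \<circ> inv_into (edges A) \<sigma>) (edges B)) ` embeddings A t \<subseteq> embeddings B t"
    using embedding_comp[OF etree_isomorphism_embedding[OF etree_isomorphism_inv[OF iso A]] _ B]
    by (auto intro!: restrict_in_embeddings B dest: embeddingsD(1))
qed

lemma etree_isomorphism_etrees:
  assumes iso: "etree_isomorphism A B f" and A: "A \<in> etrees k \<Sigma>"
  shows "B \<in> etrees k \<Sigma>"
  unfolding etrees_def
proof (intro CollectI conjI ballI)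
  note A' = etreesD[OF A]
  have B: "edges B = f ` edges A" "\<And>e. e \<in> edges A \<Longrightarrow> lab B (f e) = lab A e \<and> par B (f e) = f (par A e)"
    using iso by (auto simp: etree_isomorphism_def bij_betw_def)
  show "finite (edges B)" "lab B ` edges B \<subseteq> \<Sigma>" "par B ` edges B \<subseteq> edges B"
    using A'(1-4) B by (auto simp: image_subset_iff)
  fix u assume "u \<in> edges B"
  then obtain e where e: "e \<in> edges A" "u = f e" using B(1) by auto
  have closed: "(par A ^^ j) e \<in> edges A" for j
    by (induction j) (simp_all add: e A'(4))
  have iter: "(par B ^^ j) (f e) = f ((par A ^^ j) e)" for j
    by (induction j) (simp_all add: B(2) closed)
  obtain j where "j < k" "par A ((par A ^^ j) e) = (par A ^^ j) e" using A'(5)[OF e(1)] by blast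
  then show "\<exists>j<k. par B ((par B ^^ j) u) = (par B ^^ j) u"
    using B(2)[OF closed, of j] by (auto simp: e(2) iter)
qed

text \<open>The inputs of the theorem have edges of type \<open>nat\<close>, whereas the edges of
  blow-ups are lists; finite inputs can be carried over.\<close>

lemma nat_copy:
  assumes "A \<in> etrees k \<Sigma>"
  obtains t :: "(nat, 's) etree" and \<phi> where "etree_isomorphism (A :: ('e, 's) etree) t \<phi>" "t \<in> etrees k \<Sigma>"
proof -
  obtain \<phi> :: "'e \<Rightarrow> nat" where inj: "inj_on \<phi> (edges A)"
    using finite_imp_inj_to_nat_seg[OF etreesD(1)[OF assms]] by blast
  define t where "t = \<lparr>edges = \<phi> ` edges A, lab = lab A \<circ> inv_into (edges A) \<phi>,
    par = \<phi> \<circ> par A \<circ> inv_into (edges A) \<phi>\<rparr>"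
  have "etree_isomorphism A t \<phi>"
    using inj by (auto simp: etree_isomorphism_def t_def bij_betw_def)
  then show thesis using etree_isomorphism_etrees assms that by blast
qed

section \<open>Depth of an edge and its path to the root\<close>

definition depth :: "('e, 's) etree \<Rightarrow> 'e \<Rightarrow> nat" where
  "depth t e = (LEAST j. par t ((par t ^^ j) e) = (par t ^^ j) e)"

lemma depth_loop:
  assumes "t \<in> etrees k \<Sigma>" "e \<in> edges t"
  shows "par t ((par t ^^ depth t e) e) = (par t ^^ depth t e) e" "depth t e < k"
proof -
  obtain j where j: "j < k" "par t ((par t ^^ j) e) = (par t ^^ j) e"
    using etreesD(5)[OF assms] by blast
  from LeastI[of "\<lambda>j. par t ((par t ^^ j) e) = (par t ^^ j) e", OF j(2)]
  show "par t ((par t ^^ depth t e) e) = (par t ^^ depth t e) e" by (simp add: depth_def)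
  have "depth t e \<le> j" unfolding depth_def using j(2) by (rule Least_le)
  then show "depth t e < k" using j(1) by simp
qed

lemma depth_eq_0: "par t e = e \<Longrightarrow> depth t e = 0"
  by (simp add: depth_def)

lemma depth_par:
  assumes "t \<in> etrees k \<Sigma>" "e \<in> edges t" "par t e \<noteq> e"
  shows "depth t e = Suc (depth t (par t e))"
proof -
  have "depth t e = Suc (LEAST j. par t ((par t ^^ Suc j) e) = (par t ^^ Suc j) e)"
    unfolding depth_def using depth_loop(1)[OF assms(1,2)] assms(3) by (intro Least_Suc) auto
  then show ?thesis by (simp add: depth_def funpow_swap1)
qed

text \<open>The loop at the top is listed only once, so an edge leaving the root has a path of
  length 1; this matches list trees, where an edge is identified with its path.\<close>

definition path :: "('e, 's) etree \<Rightarrow> 'e \<Rightarrow> 'e list" where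
  "path t e = map (\<lambda>j. (par t ^^ j) e) [0..<Suc (depth t e)]"

lemma path_rec:
  assumes "t \<in> etrees k \<Sigma>" "e \<in> edges t"
  shows "path t e = e # (if par t e = e then [] else path t (par t e))"
proof (cases "par t e = e")
  case True
  then show ?thesis by (simp add: path_def depth_eq_0)
next
  case False
  have "path t e = e # map (\<lambda>j. (par t ^^ Suc j) e) [0..<depth t e]"
    unfolding path_def by (simp only: upt_rec[of 0 "Suc (depth t e)"] map_Suc_upt[symmetric])
      (simp add: comp_def)
  also have "\<dots> = e # path t (par t e)"
    unfolding path_def depth_par[OF assms False] by (simp only: funpow_Suc_right comp_def)
  finally show ?thesis using False by simp
qed

lemma length_path: "t \<in> etrees k \<Sigma> \<Longrightarrow> e \<in> edges t \<Longrightarrow> length (path t e) \<le> k"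
  using depth_loop(2) by (fastforce simp: path_def)

lemma set_path: "t \<in> etrees k \<Sigma> \<Longrightarrow> e \<in> edges t \<Longrightarrow> set (path t e) \<subseteq> edges t"
proof -
  assume t: "t \<in> etrees k \<Sigma>" and e: "e \<in> edges t"
  have "(par t ^^ j) e \<in> edges t" for j
    by (induction j) (simp_all add: e etreesD(4)[OF t])
  then show ?thesis by (auto simp: path_def)
qed

text \<open>By injectivity an embedding reflects loops as well as preserving them, so both paths
  stop after the same number of steps.\<close>

lemma path_embedding:
  assumes f: "embedding A B f" and A: "A \<in> etrees k \<Sigma>" and e: "e \<in> edges A"
  shows "path B (f e) = map f (path A e)"
proof -
  have inj: "inj_on f (edges A)" using f by (simp add: embedding_def)
  have closed: "(par A ^^ j) e \<in> edges A" for j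
    by (induction j) (simp_all add: e etreesD(4)[OF A])
  have par: "par B (f u) = f (par A u)" if "u \<in> edges A" for u
    using f that by (simp add: embedding_def)
  have iter: "(par B ^^ j) (f e) = f ((par A ^^ j) e)" for j
    by (induction j) (simp_all add: par closed)
  have "par B ((par B ^^ j) (f e)) = (par B ^^ j) (f e) \<longleftrightarrow>
      par A ((par A ^^ j) e) = (par A ^^ j) e" for j
    using closed inj by (simp add: iter par etreesD(4)[OF A] inj_on_eq_iff)
  then have "depth B (f e) = depth A e" by (simp add: depth_def)
  then show ?thesis by (simp add: path_def iter)
qed

section \<open>Extensions of a partial embedding\<close>

text \<open>Only the values of \<alpha> on \<open>A\<close> enter, so composites such as
  \<open>\<phi> \<circ> \<alpha>\<close> can be inserted without restricting them first.\<close>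

definition extensions :: "'e set \<Rightarrow> ('e, 's) etree \<Rightarrow> ('f, 's) etree \<Rightarrow> ('e \<Rightarrow> 'f) \<Rightarrow> ('e \<Rightarrow> 'f) set" where
  "extensions A B t \<alpha> = {\<beta> \<in> embeddings B t. \<forall>e\<in>A. \<beta> e = \<alpha> e}"

lemma finite_extensions:
  assumes "finite (edges B)" "finite (edges t)"
  shows "finite (extensions A B t \<alpha>)"
  using finite_embeddings[OF assms] by (simp add: extensions_def)

lemma extensions_cong: "(\<And>e. e \<in> A \<Longrightarrow> \<alpha> e = \<alpha>' e) \<Longrightarrow> extensions A B t \<alpha> = extensions A B t \<alpha>'"
  by (auto simp: extensions_def)

lemma bij_betw_extensions_target:
  assumes iso: "etree_isomorphism t t' \<phi>" and t: "par t ` edges t \<subseteq> edges t"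
    and B: "par B ` edges B \<subseteq> edges B" and A: "A \<subseteq> edges B" "\<alpha> ` A \<subseteq> edges t"
  shows "bij_betw (\<lambda>\<beta>. restrict (\<phi> \<circ> \<beta>) (edges B)) (extensions A B t \<alpha>) (extensions A B t' (\<phi> \<circ> \<alpha>))"
proof -
  have "inj_on \<phi> (edges t)" using iso by (auto simp: etree_isomorphism_def bij_betw_def)
  then have "(\<forall>e\<in>A. \<beta> e = \<alpha> e) \<longleftrightarrow> (\<forall>e\<in>A. restrict (\<phi> \<circ> \<beta>) (edges B) e = (\<phi> \<circ> \<alpha>) e)"
    if "\<beta> \<in> embeddings B t" for \<beta>
    using embeddingsD(4)[OF that] A by (auto simp: subset_iff image_subset_iff inj_on_eq_iff)
  then show ?thesis
    unfolding extensions_def by (intro bij_betw_Collect bij_betw_embeddings_target[OF iso t B]) auto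
qed

lemma bij_betw_extensions_source:
  assumes iso: "etree_isomorphism A B \<sigma>" and A: "par A ` edges A \<subseteq> edges A"
    and C: "C \<subseteq> edges A" "\<And>e. e \<in> C \<Longrightarrow> \<alpha>' (\<sigma> e) = \<alpha> e"
  shows "bij_betw (\<lambda>\<beta>. restrict (\<beta> \<circ> \<sigma>) (edges A)) (extensions (\<sigma> ` C) B t \<alpha>') (extensions C A t \<alpha>)"
  unfolding extensions_def
  using C by (intro bij_betw_Collect bij_betw_embeddings_source[OF iso A]) (auto simp: subset_iff)

section \<open>Counting tree homomorphisms into outputs\<close>

text \<open>The test trees. Children form a list because concatenation of these lists is the monoid
  operation for which the counts become characters.\<close>

datatype shape = Shape "shape list"

text \<open>Homomorphisms from the shape into the tree with arcs \<open>R\<close> that send the root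
  to \<open>x\<close>: the children of the shape choose their images independently, whence a product
  of sums.\<close>

fun tree_count :: "'x rel \<Rightarrow> shape \<Rightarrow> 'x \<Rightarrow> int" where
  "tree_count R (Shape ss) x = (\<Prod>s\<leftarrow>ss. \<Sum>y\<in>R `` {x}. tree_count R s y)"

text \<open>The count below a node \<open>(x, \<alpha>)\<close> of the output of a pattern with children \<open>ch\<close> and labels \<open>lb\<close>.\<close>

fun hom_count :: "('x \<Rightarrow> 'x set) \<Rightarrow> ('x \<Rightarrow> ('e, 's) etree) \<Rightarrow> ('f, 's) etree \<Rightarrow> shape \<Rightarrow> 'x \<Rightarrow>
    ('e \<Rightarrow> 'f) \<Rightarrow> int" where
  "hom_count ch lb t (Shape ss) x \<alpha> =
     (\<Prod>s\<leftarrow>ss. \<Sum>y\<in>ch x. \<Sum>\<beta>\<in>extensions (edges (lb x)) (lb y) t \<alpha>. hom_count ch lb t s y \<beta>)"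

lemma hom_count_cong:
  assumes "\<And>e. e \<in> edges (lb x) \<Longrightarrow> \<alpha> e = \<alpha>' e"
  shows "hom_count ch lb t s x \<alpha> = hom_count ch lb t s x \<alpha>'"
  by (cases s) (simp add: extensions_cong[OF assms])

text \<open>An isomorphism maps the children of a node bijectively onto those of its image, so the
  sums can be reindexed. The equality of these counts is what the main argument extracts from
  isomorphic outputs.\<close>

lemma rtree_isomorphism_tree_count:
  assumes iso: "rtree_isomorphism T U g" and T: "finite_rooted_tree T" and U: "finite_rooted_tree U"
    and x: "x \<in> nodes T"
  shows "tree_count (arcs T) s x = tree_count (arcs U) s (g x)"
  using x
proof (induction s arbitrary: x)
  case (Shape ss)
  have bij: "bij_betw g (nodes T) (nodes U)" and arcs: "\<And>x y. x \<in> nodes T \<Longrightarrow> y \<in> nodes T \<Longrightarrow>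
      (x, y) \<in> arcs T \<longleftrightarrow> (g x, g y) \<in> arcs U"
    using iso by (auto simp: rtree_isomorphism_def)
  have TN: "arcs T \<subseteq> nodes T \<times> nodes T" and UN: "arcs U \<subseteq> nodes U \<times> nodes U"
    using T U by (auto simp: finite_rooted_tree_def)
  have "bij_betw g (arcs T `` {x}) (arcs U `` {g x})"
    unfolding bij_betw_def
  proof
    show "inj_on g (arcs T `` {x})"
      using bij TN by (auto simp: bij_betw_def intro: inj_on_subset)
    show "g ` (arcs T `` {x}) = arcs U `` {g x}"
    proof
      show "g ` (arcs T `` {x}) \<subseteq> arcs U `` {g x}"
        using arcs TN by blast
      show "arcs U `` {g x} \<subseteq> g ` (arcs T `` {x})"
      proof
        fix v assume v: "v \<in> arcs U `` {g x}"
        then have "v \<in> nodes U" using UN by auto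
        then obtain y where "y \<in> nodes T" "v = g y" using bij by (auto simp: bij_betw_def)
        then show "v \<in> g ` (arcs T `` {x})" using v arcs Shape.prems by auto
      qed
    qed
  qed
  then have "(\<Sum>y\<in>arcs T `` {x}. tree_count (arcs U) s (g y)) =
      (\<Sum>y\<in>arcs U `` {g x}. tree_count (arcs U) s y)" for s
    by (rule sum.reindex_bij_betw)
  moreover have "(\<Sum>y\<in>arcs T `` {x}. tree_count (arcs T) s y) =
      (\<Sum>y\<in>arcs T `` {x}. tree_count (arcs U) s (g y))" if "s \<in> set ss" for s
    using Shape.IH[OF that] TN by (intro sum.cong) auto
  ultimately show ?case
    by (auto intro!: arg_cong[where f = prod_list])
qed

lemma hom_count_target_iso:
  assumes lb: "\<And>x. lb x \<in> etrees k \<Sigma>" and iso: "etree_isomorphism t t' \<phi>"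
    and t: "par t ` edges t \<subseteq> edges t"
    and sub: "\<And>x y. y \<in> ch x \<Longrightarrow> edges (lb x) \<subseteq> edges (lb y)"
    and \<alpha>: "\<alpha> ` edges (lb x) \<subseteq> edges t"
  shows "hom_count ch lb t' s x (\<phi> \<circ> \<alpha>) = hom_count ch lb t s x \<alpha>"
  using \<alpha>
proof (induction s arbitrary: x \<alpha>)
  case (Shape ss)
  have "(\<Sum>\<beta>\<in>extensions (edges (lb x)) (lb y) t' (\<phi> \<circ> \<alpha>). hom_count ch lb t' s y \<beta>) =
      (\<Sum>\<beta>\<in>extensions (edges (lb x)) (lb y) t \<alpha>. hom_count ch lb t s y \<beta>)"
    if s: "s \<in> set ss" and y: "y \<in> ch x" for s y
  proof -
    let ?r = "\<lambda>\<beta>. restrict (\<phi> \<circ> \<beta>) (edges (lb y))"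
    have "bij_betw ?r (extensions (edges (lb x)) (lb y) t \<alpha>) (extensions (edges (lb x)) (lb y) t' (\<phi> \<circ> \<alpha>))"
      using Shape.prems by (intro bij_betw_extensions_target[OF iso t] etreesD(3)[OF lb] sub[OF y])
    from sum.reindex_bij_betw[OF this, symmetric]
    have "(\<Sum>\<beta>\<in>extensions (edges (lb x)) (lb y) t' (\<phi> \<circ> \<alpha>). hom_count ch lb t' s y \<beta>) =
        (\<Sum>\<beta>\<in>extensions (edges (lb x)) (lb y) t \<alpha>. hom_count ch lb t' s y (?r \<beta>))" .
    also have "\<dots> = (\<Sum>\<beta>\<in>extensions (edges (lb x)) (lb y) t \<alpha>. hom_count ch lb t s y \<beta>)"
    proof (rule sum.cong[OF refl])
      fix \<beta> assume "\<beta> \<in> extensions (edges (lb x)) (lb y) t \<alpha>"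
      then have "\<beta> ` edges (lb y) \<subseteq> edges t" by (auto simp: extensions_def dest: embeddingsD(4))
      from Shape.IH[OF s this] show "hom_count ch lb t' s y (?r \<beta>) = hom_count ch lb t s y \<beta>"
        using hom_count_cong[of lb y "?r \<beta>" "\<phi> \<circ> \<beta>" ch t' s]
        by (simp add: comp_def)
    qed
    finally show ?thesis .
  qed
  then have "(\<Sum>y\<in>ch x. \<Sum>\<beta>\<in>extensions (edges (lb x)) (lb y) t' (\<phi> \<circ> \<alpha>). hom_count ch lb t' s y \<beta>) =
      (\<Sum>y\<in>ch x. \<Sum>\<beta>\<in>extensions (edges (lb x)) (lb y) t \<alpha>. hom_count ch lb t s y \<beta>)"
    if "s \<in> set ss" for s
    using that by (intro sum.cong) auto
  then show ?case by (auto simp only: hom_count.simps intro!: arg_cong[where f = prod_list] map_cong)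
qed

section \<open>Blow-ups of list trees\<close>

text \<open>A polynomial curve of natural vectors from \<open>a\<close> to \<open>b\<close>; along it, the polynomial functions on
  natural vectors form an integral domain.\<close>

definition curve :: "('v \<Rightarrow> nat) \<Rightarrow> ('v \<Rightarrow> nat) \<Rightarrow> nat \<Rightarrow> 'v \<Rightarrow> nat" where
  "curve a b X = (\<lambda>e. nat ((int X - 1)\<^sup>2) * a e + X\<^sup>2 * b e)"

lemma curve_0 [simp]: "curve a b 0 = a" and curve_1 [simp]: "curve a b (Suc 0) = b"
  by (auto simp: curve_def)

text \<open>Both coefficients are squares, so the two terms cannot cancel: the curve stays within
  the union of the two supports and never loses a coordinate that they share. The detour through
  \<open>int\<close> in \<open>curve\<close> avoids truncated subtraction at \<open>X = 0\<close>,
  where the coefficient of \<open>a\<close> must be 1.\<close>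

lemma curve_eq_0_iff: "curve a b X e = 0 \<longleftrightarrow> (X = 1 \<or> a e = 0) \<and> (X = 0 \<or> b e = 0)"
  by (auto simp: curve_def)

section \<open>Polynomial functions of the multiplicities\<close>

text \<open>Polynomiality is asked only along each single curve, so univariate
  \<open>int poly\<close> replaces polynomials with one variable per edge.\<close>

definition polylike :: "(('v \<Rightarrow> nat) \<Rightarrow> int) \<Rightarrow> bool" where
  "polylike f \<longleftrightarrow> (\<forall>a b. \<exists>p. \<forall>X. f (curve a b X) = poly p (int X))"

lemma polylike_const: "polylike (\<lambda>n. c)"
  unfolding polylike_def by (auto intro: exI[of _ "[:c:]"])

lemma polylike_coord: "polylike (\<lambda>n. int (n e))"
  unfolding polylike_def
proof (intro allI)
  fix a b :: "'a \<Rightarrow> nat"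
  have "int (curve a b X e) = (int X - 1)\<^sup>2 * int (a e) + (int X)\<^sup>2 * int (b e)" for X
    by (simp add: curve_def)
  then show "\<exists>p. \<forall>X. int (curve a b X e) = poly p (int X)"
    by (intro exI[of _ "[:-1, 1:]\<^sup>2 * [:int (a e):] + [:0, 1:]\<^sup>2 * [:int (b e):]"])
      (simp add: power2_eq_square algebra_simps)
qed

lemma polylike_add: "polylike f \<Longrightarrow> polylike g \<Longrightarrow> polylike (\<lambda>n. f n + g n)"
  unfolding polylike_def by (metis poly_add)

lemma polylike_diff: "polylike f \<Longrightarrow> polylike g \<Longrightarrow> polylike (\<lambda>n. f n - g n)"
  unfolding polylike_def by (metis poly_diff)

lemma polylike_mult: "polylike f \<Longrightarrow> polylike g \<Longrightarrow> polylike (\<lambda>n. f n * g n)"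
  unfolding polylike_def by (metis poly_mult)

lemma polylike_sum: "(\<And>i. i \<in> I \<Longrightarrow> polylike (f i)) \<Longrightarrow> polylike (\<lambda>n. \<Sum>i\<in>I. f i n)"
  by (induction I rule: infinite_finite_induct) (simp_all add: polylike_const polylike_add)

lemma polylike_prod_list: "(\<And>i. i \<in> set xs \<Longrightarrow> polylike (f i)) \<Longrightarrow> polylike (\<lambda>n. \<Prod>i\<leftarrow>xs. f i n)"
  by (induction xs) (simp_all add: polylike_const polylike_mult)

lemma poly_eq_of_nat:
  fixes p q :: "int poly"
  assumes "\<And>X::nat. poly p (int X) = poly q (int X)"
  shows "p = q"
proof -
  have "range int \<subseteq> {x. poly (p - q) x = 0}" using assms by auto
  then have "infinite {x. poly (p - q) x = 0}"
    using infinite_UNIV_char_0 by (metis finite_imageD finite_subset inj_on_of_nat)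
  then show ?thesis using poly_roots_finite[of "p - q"] by auto
qed

text \<open>If \<open>a\<close> is good for \<open>L\<close> and \<open>b\<close> for one more
  index, each polynomial along the curve from \<open>a\<close> to \<open>b\<close> is nonzero, being
  nonzero at 0 or at 1. So is their product, and a natural number that is not a root of it gives a
  vector good for all indices.\<close>

lemma polylike_common_nonzero:
  assumes "finite L" "\<And>l. l \<in> L \<Longrightarrow> polylike (D l)" "\<And>l. l \<in> L \<Longrightarrow> \<exists>n\<in>N. D l n \<noteq> 0"
    and N: "N \<noteq> {}" "\<And>a b X. a \<in> N \<Longrightarrow> b \<in> N \<Longrightarrow> curve a b X \<in> N"
  shows "\<exists>n\<in>N. \<forall>l\<in>L. D l n \<noteq> 0"
  using assms(1-3)
proof (induction L rule: finite_induct)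
  case empty
  then show ?case using N by auto
next
  case (insert l L)
  from insert obtain a where a: "a \<in> N" "\<forall>l\<in>L. D l a \<noteq> 0" by blast
  from insert.prems(2)[of l] obtain b where b: "b \<in> N" "D l b \<noteq> 0" by blast
  have "\<forall>l\<in>insert l L. \<exists>p. \<forall>X. D l (curve a b X) = poly p (int X)"
    using insert.prems(1) unfolding polylike_def by blast
  then obtain P where P: "\<And>l' X. l' \<in> insert l L \<Longrightarrow> D l' (curve a b X) = poly (P l') (int X)"
    by metis
  have "P l' \<noteq> 0" if "l' \<in> insert l L" for l'
    using P[OF that, of 0] P[OF that, of 1] that a(2) b(2) by auto
  then have "(\<Prod>l'\<in>insert l L. P l') \<noteq> 0" using insert.hyps by auto
  then obtain X where "poly (\<Prod>l'\<in>insert l L. P l') (int X) \<noteq> 0"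
    using poly_eq_of_nat[of "\<Prod>l'\<in>insert l L. P l'" 0] by auto
  then have "\<forall>l'\<in>insert l L. D l' (curve a b X) \<noteq> 0"
    using P insert.hyps(1) by (auto simp: poly_prod)
  then show ?case using N(2)[OF a(1) b(1)] by blast
qed

section \<open>List trees with multiplicities\<close>

definition list_parent :: "'a list \<Rightarrow> 'a list" where
  "list_parent xs = (if tl xs = [] then xs else tl xs)"

text \<open>Every nonempty suffix obeys its own bound, so multiplicity zero removes an edge together
  with all that lies below it. The bound is looked up at the projection and is thus the same below
  every copy of the parent.\<close>

fun admissible :: "('v list \<Rightarrow> nat) \<Rightarrow> ('v \<times> nat) list \<Rightarrow> bool" where
  "admissible n [] \<longleftrightarrow> True"
| "admissible n ((v, c) # xs) \<longleftrightarrow> c < n (v # map fst xs) \<and> admissible n xs"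

text \<open>A nonempty list is an edge, identified with the path from it up to the root. The \<open>n e\<close> copies
  of the edge \<open>e\<close> below a given copy of its parent edge are told apart by their second component.\<close>

definition blow_up :: "(('s \<times> 'c) list \<Rightarrow> nat) \<Rightarrow> ((('s \<times> 'c) \<times> nat) list, 's) etree" where
  "blow_up n = \<lparr>edges = {xs. xs \<noteq> [] \<and> admissible n xs}, lab = (\<lambda>xs. fst (fst (hd xs))), par = list_parent\<rparr>"

lemma blow_up_simps [simp]:
  "xs \<in> edges (blow_up n) \<longleftrightarrow> xs \<noteq> [] \<and> admissible n xs"
  "lab (blow_up n) xs = fst (fst (hd xs))" "par (blow_up n) = list_parent"
  by (simp_all add: blow_up_def)

lemma admissible_tl: "admissible n xs \<Longrightarrow> admissible n (tl xs)"
  by (cases xs) auto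

lemma list_parent_nonempty [simp]: "list_parent xs = [] \<longleftrightarrow> xs = []"
  by (auto simp: list_parent_def)

lemma list_parent_map: "list_parent (map f xs) = map f (list_parent xs)"
  by (cases "tl xs") (simp_all add: list_parent_def flip: map_tl)

lemma list_parent_funpow_loop:
  "xs \<noteq> [] \<Longrightarrow> list_parent ((list_parent ^^ (length xs - 1)) xs) = (list_parent ^^ (length xs - 1)) xs"
proof (induction xs)
  case (Cons x xs)
  then show ?case
    by (cases xs) (auto simp: list_parent_def funpow_swap1 simp del: funpow.simps(2)
      simp: funpow_Suc_right)
qed simp

lemma finite_admissible:
  assumes "finite {e. n e \<noteq> 0}"
  shows "finite {xs. xs \<noteq> [] \<and> admissible n xs}"
proof -
  let ?S = "{e. n e \<noteq> 0}"
  have supp: "map fst xs \<in> ?S" if "xs \<noteq> []" "admissible n xs" for xs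
    using that by (cases xs) auto
  \<comment> \<open>For an empty support the maxima in \<open>K\<close> and \<open>m\<close> are
    unspecified, but then no nonempty list is admissible and the bounds hold vacuously.\<close>
  define K where "K = Suc (Max (n ` ?S))"
  define V where "V = \<Union> (set ` ?S)"
  have finV: "finite V" using assms by (auto simp: V_def)
  have bound: "set xs \<subseteq> V \<times> {..<K}" if "admissible n xs" for xs
    using that
  proof (induction xs)
    case (Cons x xs)
    obtain v c where x: "x = (v, c)" by force
    have c: "c < n (v # map fst xs)" using Cons.prems x by simp
    then have e: "v # map fst xs \<in> ?S" by auto
    then have "n (v # map fst xs) \<le> Max (n ` ?S)" using assms by (intro Max_ge) auto
    then have "c < K" using c by (simp add: K_def)
    moreover have "v \<in> V" using e by (force simp: V_def)
    ultimately show ?case using Cons x by simp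
  qed simp
  define m where "m = Max (length ` ?S)"
  have len: "length xs \<le> m" if "xs \<noteq> []" "admissible n xs" for xs
  proof -
    have "length (map fst xs) \<in> length ` ?S" using supp[OF that] by blast
    then have "length (map fst xs) \<le> m" unfolding m_def using assms by (intro Max_ge) auto
    then show ?thesis by simp
  qed
  have "{xs. xs \<noteq> [] \<and> admissible n xs} \<subseteq> {xs. set xs \<subseteq> V \<times> {..<K} \<and> length xs \<le> m}"
    using bound len by auto
  then show ?thesis
    using finite_lists_length_le[of "V \<times> {..<K}" m] finV by (auto intro: finite_subset)
qed

lemma blow_up_etrees:
  assumes "finite {e. n e \<noteq> 0}"
    and supp: "\<And>e. n e \<noteq> 0 \<Longrightarrow> e \<noteq> [] \<and> length e \<le> k \<and> fst (hd e) \<in> \<Sigma>"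
  shows "blow_up n \<in> etrees k \<Sigma>"
  unfolding etrees_def
proof (intro CollectI conjI ballI)
  have n: "n (map fst xs) \<noteq> 0" if "xs \<in> edges (blow_up n)" for xs
    using that by (cases xs) auto
  have "edges (blow_up n) = {xs. xs \<noteq> [] \<and> admissible n xs}" by auto
  then show "finite (edges (blow_up n))" using finite_admissible[OF assms(1)] by metis
  show "lab (blow_up n) ` edges (blow_up n) \<subseteq> \<Sigma>"
    using supp[OF n] by (auto simp: hd_map)
  show "par (blow_up n) ` edges (blow_up n) \<subseteq> edges (blow_up n)"
    by (auto simp: list_parent_def admissible_tl)
  fix xs assume xs: "xs \<in> edges (blow_up n)"
  have "length xs \<le> k" using supp[OF n[OF xs]] by simp
  then show "\<exists>j<k. par (blow_up n) ((par (blow_up n) ^^ j) xs) = (par (blow_up n) ^^ j) xs"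
    using xs list_parent_funpow_loop[of xs]
    by (intro exI[of _ "length xs - 1"]) (cases xs; auto)
qed

text \<open>The candidates for the image of a new edge \<open>a\<close>, given the embedding \<open>\<alpha>\<close> of a set \<open>A\<close> of edges that
  contains the parent of \<open>a\<close>: all copies of \<open>b a\<close> below \<open>\<alpha> (par B a)\<close> not yet used by siblings.\<close>

lemma card_new_images:
  assumes emb: "embedding (B\<lparr>edges := A\<rparr>) (blow_up n) \<alpha>" and A: "finite A" "par B ` A \<subseteq> A"
    and proj: "\<And>e. e \<in> A \<Longrightarrow> map fst (\<alpha> e) = b e"
    and a: "par B a \<in> insert a A"
    and ok: "b a \<noteq> []" "tl (b a) = (if par B a = a then [] else b (par B a))"
      "par B a \<noteq> a \<Longrightarrow> b (par B a) \<noteq> []"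
  shows "int (card {v \<in> edges (blow_up n). map fst v = b a \<and>
      tl v = (if par B a = a then [] else \<alpha> (par B a)) \<and> v \<notin> \<alpha> ` A}) =
    int (n (b a)) - int (card {e \<in> A. b e = b a \<and> (par B a \<noteq> a \<longrightarrow> par B e = par B a)})"
proof -
  define ys where "ys = (if par B a = a then [] else \<alpha> (par B a))"
  define K where "K = {e \<in> A. b e = b a \<and> (par B a \<noteq> a \<longrightarrow> par B e = par B a)}"
  define V where "V = (\<lambda>c. (hd (b a), c) # ys) ` {..<n (b a)}"
  have inj: "inj_on \<alpha> A" and img: "\<And>e. e \<in> A \<Longrightarrow> \<alpha> e \<noteq> [] \<and> admissible n (\<alpha> e)"
    and par: "\<And>e. e \<in> A \<Longrightarrow> list_parent (\<alpha> e) = \<alpha> (par B e)"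
    using emb by (auto simp: embedding_def image_subset_iff)
  have ys: "map fst ys = tl (b a)" "admissible n ys"
    using ok(2) proj[of "par B a"] img[of "par B a"] a by (cases "par B a = a"; simp add: ys_def)+
  have ba: "b a = hd (b a) # tl (b a)" using ok(1) by simp
  have V: "v \<in> V \<longleftrightarrow> v \<in> edges (blow_up n) \<and> map fst v = b a \<and> tl v = ys" for v
  proof
    assume "v \<in> V"
    then show "v \<in> edges (blow_up n) \<and> map fst v = b a \<and> tl v = ys"
      using ys ba by (auto simp: V_def)
  next
    assume v: "v \<in> edges (blow_up n) \<and> map fst v = b a \<and> tl v = ys"
    then have "hd (b a) = fst (hd v)" by (metis blow_up_simps(1) hd_map)
    then have "v = (hd (b a), snd (hd v)) # ys" using v by (cases v) auto
    then obtain c where "v = (hd (b a), c) # ys" ..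
    moreover from this have "c < n (b a)" using v ys ba by auto
    ultimately show "v \<in> V" by (auto simp: V_def)
  qed
  \<comment> \<open>The copies already taken are those of the edges in \<open>K\<close>, a set that
    does not depend on \<alpha> or \<open>n\<close>. Hence the number of free copies is linear in
    \<open>n (b a)\<close>.\<close>
  have used: "e \<in> K \<longleftrightarrow> \<alpha> e \<in> V" if e: "e \<in> A" for e
  proof -
    have "tl (\<alpha> e) = ys \<longleftrightarrow> (par B a \<noteq> a \<longrightarrow> par B e = par B a)" if be: "b e = b a"
    proof (cases "par B a = a")
      case True
      have "map fst (tl (\<alpha> e)) = tl (b a)" using proj[OF e] be by (simp add: map_tl)
      then show ?thesis using True ok(2) by (simp add: ys_def)
    next
      case False
      then have pa: "par B a \<in> A" using a by auto
      have "map fst (tl (\<alpha> e)) = b (par B a)" using proj[OF e] be ok(2) False by (simp add: map_tl)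
      then have "tl (\<alpha> e) \<noteq> []" using ok(3)[OF False] by auto
      then have "tl (\<alpha> e) = \<alpha> (par B e)" using par[OF e] by (simp add: list_parent_def)
      moreover have "par B e \<in> A" using e A(2) by auto
      ultimately show ?thesis using False pa inj by (auto simp: ys_def inj_on_eq_iff)
    qed
    then show ?thesis using V[of "\<alpha> e"] proj[OF e] img[OF e] e by (auto simp: K_def)
  qed
  have "K \<subseteq> A" by (auto simp: K_def)
  then have cardK: "card (\<alpha> ` K) = card K" "\<alpha> ` K \<subseteq> V"
    using inj used by (auto intro: card_image inj_on_subset)
  have "{v \<in> edges (blow_up n). map fst v = b a \<and> tl v = ys \<and> v \<notin> \<alpha> ` A} = V - \<alpha> ` K"
    using V used \<open>K \<subseteq> A\<close> by blast
  moreover have "card V = n (b a)"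
    unfolding V_def by (subst card_image) (auto intro: inj_onI)
  moreover have "finite V" by (simp add: V_def)
  moreover have "int (card (V - \<alpha> ` K)) = int (card V) - int (card (\<alpha> ` K))"
    using cardK(2) \<open>finite V\<close> by (simp add: card_Diff_subset finite_subset card_mono of_nat_diff)
  ultimately show ?thesis using cardK(1) by (simp add: K_def ys_def)
qed

section \<open>Counting the extensions over a fixed projection\<close>

text \<open>With the projection prescribed on all of \<open>B\<close>, an extension amounts to a
  choice of copy numbers, which is what makes the count polynomial.\<close>

definition extensions_over ::
    "'e set \<Rightarrow> ('e, 's) etree \<Rightarrow> ('e \<Rightarrow> ('s \<times> 'c) list) \<Rightarrow> (('s \<times> 'c) list \<Rightarrow> nat) \<Rightarrow>
      ('e \<Rightarrow> (('s \<times> 'c) \<times> nat) list) \<Rightarrow> ('e \<Rightarrow> (('s \<times> 'c) \<times> nat) list) set" where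
  "extensions_over A B b n \<alpha> = {\<beta> \<in> extensions A B (blow_up n) \<alpha>. \<forall>e\<in>edges B. map fst (\<beta> e) = b e}"

lemma embedding_insert:
  assumes emb: "embedding (B\<lparr>edges := A\<rparr>) t \<alpha>" and A: "par B ` A \<subseteq> A" "a \<notin> A"
    and v: "v \<in> edges t" "v \<notin> \<alpha> ` A" "lab t v = lab B a"
      "par t v = (if par B a = a then v else \<alpha> (par B a))"
    and a: "par B a \<in> insert a A"
  shows "embedding (B\<lparr>edges := insert a A\<rparr>) t (\<alpha>(a := v))"
proof -
  have "\<forall>e\<in>A. par B e \<noteq> a" using A by auto
  then show ?thesis
    using emb A v a unfolding embedding_def
    by (auto simp: inj_on_def image_subset_iff split: if_splits)
qed

text \<open>What the existence of an embedding over \<open>b\<close> forces on \<open>b\<close> at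
  \<open>a\<close>. For the tails: \<beta> reflects loops by injectivity, and the nonempty lists
  fixed by \<open>list_parent\<close> are those of length one.\<close>

lemma embedding_insertD:
  assumes emb: "embedding B (blow_up n) \<beta>" and a: "a \<in> edges B" "par B a \<in> edges B"
    and proj: "\<And>e. e \<in> edges B \<Longrightarrow> map fst (\<beta> e) = b e"
  shows "b a \<noteq> []" "fst (hd (b a)) = lab B a"
    "tl (b a) = (if par B a = a then [] else b (par B a))" "b (par B a) \<noteq> []"
    "tl (\<beta> a) = (if par B a = a then [] else \<beta> (par B a))"
proof -
  have "inj_on \<beta> (edges B)" using emb by (simp add: embedding_def)
  then have eq: "\<beta> (par B a) = \<beta> a \<longleftrightarrow> par B a = a" using a by (simp add: inj_on_eq_iff)
  have \<beta>: "\<beta> a \<noteq> []" "\<beta> (par B a) \<noteq> []" "fst (fst (hd (\<beta> a))) = lab B a"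
    "list_parent (\<beta> a) = \<beta> (par B a)"
    using emb a by (simp_all add: embedding_def image_subset_iff)
  show tl: "tl (\<beta> a) = (if par B a = a then [] else \<beta> (par B a))"
  proof (cases "tl (\<beta> a) = []")
    case True
    then have "list_parent (\<beta> a) = \<beta> a" by (simp add: list_parent_def)
    then have "par B a = a" using \<beta>(4) eq by metis
    then show ?thesis using True by simp
  next
    case False
    then have *: "list_parent (\<beta> a) = tl (\<beta> a)" by (simp add: list_parent_def)
    have "tl (\<beta> a) \<noteq> \<beta> a" using \<beta>(1) by (cases "\<beta> a") auto
    then have "par B a \<noteq> a" using \<beta>(4) eq * by metis
    then show ?thesis using \<beta>(4) * by simp
  qed
  show "b a \<noteq> []" "b (par B a) \<noteq> []" "fst (hd (b a)) = lab B a"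
    using \<beta>(1-3) hd_map[of "\<beta> a" fst] by (simp_all flip: proj[OF a(1)] proj[OF a(2)])
  show "tl (b a) = (if par B a = a then [] else b (par B a))"
    using tl by (simp flip: proj[OF a(1)] proj[OF a(2)] map_tl)
qed

text \<open>The missing edges of \<open>B\<close> are placed one at a time, parents first. Each
  gives a factor \<open>n (b a)\<close> minus the number of copies taken by siblings, whatever
  copies were chosen before. So the count is a product of linear factors, the same for every
  \<alpha>; hence the quantifier over \<open>w\<close> comes first.\<close>

lemma polynomial_extension_count:
  assumes B: "B \<in> etrees k \<Sigma>" and A: "A \<subseteq> edges B" "par B ` A \<subseteq> A"
  shows "\<exists>w. polylike w \<and> (\<forall>n \<alpha>. finite (edges (blow_up n)) \<longrightarrow> embedding (B\<lparr>edges := A\<rparr>) (blow_up n) \<alpha> \<longrightarrow>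
    (\<forall>e\<in>A. map fst (\<alpha> e) = b e) \<longrightarrow> int (card (extensions_over A B b n \<alpha>)) = w n)"
  using A
proof (induction "card (edges B - A)" arbitrary: A)
  case 0
  note finB = etreesD(1)[OF B]
  have AB: "A = edges B" using 0 finB by auto
  have "extensions_over A B b n \<alpha> = {restrict \<alpha> (edges B)}"
    if "embedding (B\<lparr>edges := A\<rparr>) (blow_up n) \<alpha>" "\<forall>e\<in>A. map fst (\<alpha> e) = b e" for n \<alpha>
  proof -
    have "restrict \<alpha> (edges B) \<in> embeddings B (blow_up n)"
      using that(1) AB by (intro restrict_in_embeddings etreesD(3)[OF B]) simp
    then show ?thesis
      using that(2) AB by (auto simp: extensions_over_def extensions_def
        intro!: extensionalityI[where A = "edges B"] dest: embeddingsD(2))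
  qed
  then show ?case by (intro exI[of _ "\<lambda>_. 1"]) (auto simp: polylike_const)
next
  case (Suc d)
  note finB = etreesD(1)[OF B]
  have "edges B - A \<noteq> {}" using Suc.hyps(2) by (metis card.empty nat.distinct(1))
  \<comment> \<open>An edge of least depth outside \<open>A\<close> is a loop or has its parent in
    \<open>A\<close>.\<close>
  then obtain a where a: "a \<in> edges B" "a \<notin> A" and min: "\<And>e. e \<in> edges B - A \<Longrightarrow> depth B a \<le> depth B e"
    using arg_min_if_finite(1)[of "edges B - A" "depth B"] arg_min_least[of "edges B - A" _ "depth B"] finB
    by (metis DiffE finite_Diff)
  have pa: "par B a \<in> insert a A"
    using depth_par[OF B a(1)] min[of "par B a"] etreesD(4)[OF B a(1)] by fastforce
  have A': "insert a A \<subseteq> edges B" "par B ` insert a A \<subseteq> insert a A"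
    using Suc.prems a pa by auto
  have finA: "finite A" using Suc.prems(1) finB by (rule finite_subset)
  have "d = card (edges B - insert a A)"
  proof -
    have "edges B - insert a A = (edges B - A) - {a}" by auto
    then show ?thesis using Suc.hyps(2) a finB by (simp add: card_Diff_singleton)
  qed
  from Suc.hyps(1)[OF this A'] obtain w where w: "polylike w"
    "\<And>n \<alpha>. finite (edges (blow_up n)) \<Longrightarrow> embedding (B\<lparr>edges := insert a A\<rparr>) (blow_up n) \<alpha> \<Longrightarrow>
      (\<forall>e\<in>insert a A. map fst (\<alpha> e) = b e) \<Longrightarrow>
      int (card (extensions_over (insert a A) B b n \<alpha>)) = w n"
    by blast
  \<comment> \<open>If \<open>ok\<close> fails, no embedding lies over \<open>b\<close> and the
    polynomial is 0.\<close>
  define ok where "ok \<longleftrightarrow> b a \<noteq> [] \<and> fst (hd (b a)) = lab B a \<and>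
    tl (b a) = (if par B a = a then [] else b (par B a)) \<and> b (par B a) \<noteq> []"
  show ?case
  proof (cases ok)
    case False
    have "extensions_over A B b n \<alpha> = {}" for n \<alpha>
    proof (rule ccontr)
      assume "extensions_over A B b n \<alpha> \<noteq> {}"
      then obtain \<beta> where \<beta>: "embedding B (blow_up n) \<beta>" "\<And>e. e \<in> edges B \<Longrightarrow> map fst (\<beta> e) = b e"
        by (auto simp: extensions_over_def extensions_def dest: embeddingsD(1))
      show False
        using False embedding_insertD(1-4)[OF \<beta>(1) a(1) etreesD(4)[OF B a(1)] \<beta>(2)] unfolding ok_def by blast
    qed
    then show ?thesis by (intro exI[of _ "\<lambda>_. 0"]) (auto simp: polylike_const)
  next
    case True
    let ?k = "card {e \<in> A. b e = b a \<and> (par B a \<noteq> a \<longrightarrow> par B e = par B a)}"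
    have pl: "polylike (\<lambda>n. (int (n (b a)) - int ?k) * w n)"
      by (intro polylike_mult polylike_diff polylike_coord polylike_const w(1))
    have count: "int (card (extensions_over A B b n \<alpha>)) = (int (n (b a)) - int ?k) * w n"
      if fin: "finite (edges (blow_up n))" and emb: "embedding (B\<lparr>edges := A\<rparr>) (blow_up n) \<alpha>"
        and proj: "\<forall>e\<in>A. map fst (\<alpha> e) = b e" for n \<alpha>
    proof -
      define V where "V = {v \<in> edges (blow_up n). map fst v = b a \<and>
        tl v = (if par B a = a then [] else \<alpha> (par B a)) \<and> v \<notin> \<alpha> ` A}"
      let ?E = "\<lambda>v. extensions_over (insert a A) B b n (\<alpha>(a := v))"
      have split: "extensions_over A B b n \<alpha> = (\<Union>v\<in>V. ?E v)"
      proof (intro equalityI subsetI)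
        fix \<beta> assume \<beta>: "\<beta> \<in> extensions_over A B b n \<alpha>"
        then have emb\<beta>: "embedding B (blow_up n) \<beta>" and proj\<beta>: "\<And>e. e \<in> edges B \<Longrightarrow> map fst (\<beta> e) = b e"
          and agree: "\<And>e. e \<in> A \<Longrightarrow> \<beta> e = \<alpha> e"
          by (auto simp: extensions_over_def extensions_def dest: embeddingsD(1))
        have "tl (\<beta> a) = (if par B a = a then [] else \<alpha> (par B a))"
          using embedding_insertD(5)[OF emb\<beta> a(1) etreesD(4)[OF B a(1)] proj\<beta>] pa agree by auto
        moreover have "\<beta> a \<notin> \<alpha> ` A"
        proof
          assume "\<beta> a \<in> \<alpha> ` A"
          then obtain e where e: "e \<in> A" "\<beta> a = \<beta> e" using agree by auto
          moreover have "inj_on \<beta> (edges B)" using emb\<beta> by (simp add: embedding_def)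
          ultimately have "a = e" using a(1) Suc.prems(1) by (meson inj_onD subsetD)
          then show False using e(1) a(2) by simp
        qed
        moreover have "\<beta> a \<in> edges (blow_up n)" using emb\<beta> a(1) by (auto simp: embedding_def)
        ultimately have "\<beta> a \<in> V" using proj\<beta>[OF a(1)] by (simp add: V_def)
        moreover have "\<beta> \<in> ?E (\<beta> a)"
          using \<beta> agree by (auto simp: extensions_over_def extensions_def)
        ultimately show "\<beta> \<in> (\<Union>v\<in>V. ?E v)" by blast
      next
        fix \<beta> assume "\<beta> \<in> (\<Union>v\<in>V. ?E v)"
        then obtain v where \<beta>: "\<beta> \<in> ?E v" by blast
        have "\<beta> e = \<alpha> e" if "e \<in> A" for e
        proof -
          have "e \<noteq> a" using that a(2) by blast
          then show ?thesis using \<beta> that by (simp add: extensions_over_def extensions_def)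
        qed
        then show "\<beta> \<in> extensions_over A B b n \<alpha>"
          using \<beta> by (simp add: extensions_over_def extensions_def)
      qed
      have "finite V" unfolding V_def using fin by (rule finite_subset[rotated]) auto
      have finE: "finite (?E v)" for v
        using finite_extensions[OF finB fin, of "insert a A" "\<alpha>(a := v)"]
        by (rule finite_subset[rotated]) (auto simp: extensions_over_def)
      have disj: "?E v \<inter> ?E v' = {}" if "v \<noteq> v'" for v v'
        using that by (auto simp: extensions_over_def extensions_def)
      have "int (card (?E v)) = w n" if v: "v \<in> V" for v
      proof (rule w(2)[OF fin])
        have v': "v \<noteq> []" "admissible n v" "map fst v = b a"
          "tl v = (if par B a = a then [] else \<alpha> (par B a))" "v \<notin> \<alpha> ` A"
          using v by (auto simp: V_def)
        have "fst (fst (hd v)) = lab B a" using True hd_map[OF v'(1), of fst] v'(3) by (simp add: ok_def)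
        moreover have "list_parent v = (if par B a = a then v else \<alpha> (par B a))"
        proof (cases "par B a = a")
          case False
          then have "\<alpha> (par B a) \<in> edges (blow_up n)"
            using emb pa by (simp add: embedding_def image_subset_iff)
          then show ?thesis using v'(4) False by (simp add: list_parent_def)
        qed (use v'(4) in \<open>simp add: list_parent_def\<close>)
        ultimately show "embedding (B\<lparr>edges := insert a A\<rparr>) (blow_up n) (\<alpha>(a := v))"
          using v' a(2) pa Suc.prems(2) by (intro embedding_insert[OF emb]) auto
        show "\<forall>e\<in>insert a A. map fst ((\<alpha>(a := v)) e) = b e"
          using proj v' a(2) by auto
      qed
      then have "int (card (extensions_over A B b n \<alpha>)) = (\<Sum>v\<in>V. w n)"
        unfolding split using disj finE \<open>finite V\<close> by (subst card_UN_disjoint) auto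
      also have "\<dots> = int (card V) * w n" by simp
      also have "int (card V) = int (n (b a)) - int ?k"
        unfolding V_def using True proj
        by (intro card_new_images emb finA Suc.prems(2) pa) (auto simp: ok_def)
      finally show ?thesis .
    qed
    show ?thesis
    proof (intro exI conjI)
      show "polylike (\<lambda>n. (int (n (b a)) - int ?k) * w n)" by (rule pl)
      show "\<forall>n \<alpha>. finite (edges (blow_up n)) \<longrightarrow> embedding (B\<lparr>edges := A\<rparr>) (blow_up n) \<alpha> \<longrightarrow>
          (\<forall>e\<in>A. map fst (\<alpha> e) = b e) \<longrightarrow>
          int (card (extensions_over A B b n \<alpha>)) = (int (n (b a)) - int ?k) * w n"
        using count by (intro allI impI)
    qed
  qed
qed

definition extension_poly ::
    "'e set \<Rightarrow> ('e, 's) etree \<Rightarrow> ('e \<Rightarrow> ('s \<times> 'c) list) \<Rightarrow> (('s \<times> 'c) list \<Rightarrow> nat) \<Rightarrow> int" where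
  "extension_poly A B b = (SOME w. polylike w \<and>
    (\<forall>n \<alpha>. finite (edges (blow_up n)) \<longrightarrow> embedding (B\<lparr>edges := A\<rparr>) (blow_up n) \<alpha> \<longrightarrow>
      (\<forall>e\<in>A. map fst (\<alpha> e) = b e) \<longrightarrow> int (card (extensions_over A B b n \<alpha>)) = w n))"

lemma extension_poly:
  assumes "B \<in> etrees k \<Sigma>" "A \<subseteq> edges B" "par B ` A \<subseteq> A"
  shows "polylike (extension_poly A B b)"
    "finite (edges (blow_up n)) \<Longrightarrow> embedding (B\<lparr>edges := A\<rparr>) (blow_up n) \<alpha> \<Longrightarrow>
      (\<And>e. e \<in> A \<Longrightarrow> map fst (\<alpha> e) = b e) \<Longrightarrow>
      int (card (extensions_over A B b n \<alpha>)) = extension_poly A B b n"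
  using someI_ex[OF polynomial_extension_count[OF assms, of b], folded extension_poly_def] by blast+

text \<open>Neither compatibility with labels and parents nor injectivity is built in: incompatible
  functions have an empty fibre, and siblings may well go to different copies of one edge.\<close>

definition projections :: "'u set \<Rightarrow> 'e set \<Rightarrow> ('e, 's) etree \<Rightarrow> ('e \<Rightarrow> 'u) \<Rightarrow> ('e \<Rightarrow> 'u) set" where
  "projections U A B b = {c \<in> edges B \<rightarrow>\<^sub>E U. \<forall>e\<in>A. c e = b e}"

lemma finite_projections: "finite U \<Longrightarrow> finite (edges B) \<Longrightarrow> finite (projections U A B b)"
  unfolding projections_def by (rule finite_subset[OF _ finite_PiE[of "edges B" "\<lambda>_. U"]]) auto

definition supported :: "'v list set \<Rightarrow> ('v list \<Rightarrow> nat) \<Rightarrow> bool" where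
  "supported U n \<longleftrightarrow> (\<forall>e. n e \<noteq> 0 \<longrightarrow> e \<in> U)"

lemma supportedD:
  assumes "supported U n" "xs \<noteq> []" "admissible n xs"
  shows "map fst xs \<in> U"
proof (cases xs)
  case (Cons x ys)
  then show ?thesis using assms by (cases x) (auto simp: supported_def)
qed (use assms in simp)

lemma finite_edges_blow_up:
  assumes "supported U n" "finite U"
  shows "finite (edges (blow_up n))"
proof -
  have "finite {e. n e \<noteq> 0}"
    using assms by (auto simp: supported_def intro: finite_subset[of _ U])
  moreover have "edges (blow_up n) = {xs. xs \<noteq> [] \<and> admissible n xs}" by auto
  ultimately show ?thesis using finite_admissible by metis
qed

text \<open>The extensions are partitioned by their projection to \<open>U\<close>; on each fibre
  \<open>f\<close> is constant, and the size of the fibre is the polynomial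
  \<open>extension_poly\<close>.\<close>

lemma sum_extensions_blow_up:
  assumes U: "supported U n" "finite U" and B: "B \<in> etrees k \<Sigma>" and A: "A \<subseteq> edges B" "par B ` A \<subseteq> A"
    and \<alpha>: "embedding (B\<lparr>edges := A\<rparr>) (blow_up n) \<alpha>" "\<And>e. e \<in> A \<Longrightarrow> map fst (\<alpha> e) = b e"
    and f: "\<And>\<beta> c. \<beta> \<in> embeddings B (blow_up n) \<Longrightarrow> (\<And>e. e \<in> edges B \<Longrightarrow> map fst (\<beta> e) = c e) \<Longrightarrow>
      f \<beta> = g c"
  shows "(\<Sum>\<beta>\<in>extensions A B (blow_up n) \<alpha>. f \<beta>) =
    (\<Sum>c\<in>projections U A B b. extension_poly A B c n * g c)"
proof -
  note finU = finite_edges_blow_up[OF U]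
  note finB = etreesD(1)[OF B]
  have "extensions A B (blow_up n) \<alpha> = (\<Union>c\<in>projections U A B b. extensions_over A B c n \<alpha>)"
  proof (intro equalityI subsetI)
    fix \<beta> assume \<beta>: "\<beta> \<in> extensions A B (blow_up n) \<alpha>"
    define c where "c = restrict (\<lambda>e. map fst (\<beta> e)) (edges B)"
    have "map fst (\<beta> e) \<in> U" if "e \<in> edges B" for e
      using \<beta> that by (intro supportedD[OF U(1)]) (auto simp: extensions_def dest: embeddingsD(4))
    then have "c \<in> projections U A B b"
      using \<beta> \<alpha>(2) A(1) by (auto simp: projections_def c_def extensions_def subset_iff)
    moreover have "\<beta> \<in> extensions_over A B c n \<alpha>"
      using \<beta> by (simp add: extensions_over_def c_def)
    ultimately show "\<beta> \<in> (\<Union>c\<in>projections U A B b. extensions_over A B c n \<alpha>)" by blast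
  qed (auto simp: extensions_over_def)
  then have "(\<Sum>\<beta>\<in>extensions A B (blow_up n) \<alpha>. f \<beta>) =
      (\<Sum>\<beta>\<in>(\<Union>c\<in>projections U A B b. extensions_over A B c n \<alpha>). f \<beta>)" by simp
  also have "\<dots> = (\<Sum>c\<in>projections U A B b. \<Sum>\<beta>\<in>extensions_over A B c n \<alpha>. f \<beta>)"
  proof (rule sum.UNION_disjoint)
    show "finite (projections U A B b)" using U(2) finB by (rule finite_projections)
    show "\<forall>c\<in>projections U A B b. finite (extensions_over A B c n \<alpha>)"
      using finite_extensions[OF finB finU] by (auto simp: extensions_over_def)
    have "c = c'" if c: "c \<in> projections U A B b" "c' \<in> projections U A B b"
      and \<beta>: "\<beta> \<in> extensions_over A B c n \<alpha>" "\<beta> \<in> extensions_over A B c' n \<alpha>" for c c' \<beta>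
    proof (rule PiE_ext)
      show "c \<in> edges B \<rightarrow>\<^sub>E U" "c' \<in> edges B \<rightarrow>\<^sub>E U" using c by (simp_all add: projections_def)
      show "c e = c' e" if "e \<in> edges B" for e
        using \<beta> that by (simp add: extensions_over_def)
    qed
    then show "\<forall>c\<in>projections U A B b. \<forall>c'\<in>projections U A B b. c \<noteq> c' \<longrightarrow>
        extensions_over A B c n \<alpha> \<inter> extensions_over A B c' n \<alpha> = {}" by blast
  qed
  also have "\<dots> = (\<Sum>c\<in>projections U A B b. extension_poly A B c n * g c)"
  proof (rule sum.cong[OF refl])
    fix c assume c: "c \<in> projections U A B b"
    have "(\<Sum>\<beta>\<in>extensions_over A B c n \<alpha>. f \<beta>) = (\<Sum>\<beta>\<in>extensions_over A B c n \<alpha>. g c)"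
      by (intro sum.cong f) (auto simp: extensions_over_def extensions_def)
    also have "\<dots> = int (card (extensions_over A B c n \<alpha>)) * g c" by simp
    also have "int (card (extensions_over A B c n \<alpha>)) = extension_poly A B c n"
      using \<alpha> c by (intro extension_poly(2)[OF B A finU]) (auto simp: projections_def)
    finally show "(\<Sum>\<beta>\<in>extensions_over A B c n \<alpha>. f \<beta>) = extension_poly A B c n * g c" .
  qed
  finally show ?thesis .
qed

section \<open>Pattern systems and their counts on blow-ups\<close>

text \<open>Both patterns will be put into one system on a sum type, so that nodes of either can be
  compared. The counts recurse on the shape, and children and labels are all the structure they
  see.\<close>

locale pattern_system =
  fixes ch :: "'x \<Rightarrow> 'x set" and lb :: "'x \<Rightarrow> ('e, 's) etree" and k :: nat and \<Sigma> :: "'s set"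
  assumes finite_ch: "finite (ch x)" and lb_etrees: "lb x \<in> etrees k \<Sigma>"
    and induced: "y \<in> ch x \<Longrightarrow> induced_substructure (lb x) (lb y)"
begin

lemma edges_ch: "y \<in> ch x \<Longrightarrow> edges (lb x) \<subseteq> edges (lb y)"
  and par_ch: "y \<in> ch x \<Longrightarrow> par (lb y) ` edges (lb x) \<subseteq> edges (lb x)"
  using induced by (auto simp: induced_substructure_def)

lemma embedding_ch:
  assumes "y \<in> ch x"
  shows "embedding ((lb y)\<lparr>edges := edges (lb x)\<rparr>) t \<alpha> \<longleftrightarrow> embedding (lb x) t \<alpha>"
proof -
  have "lab (lb x) e = lab (lb y) e \<and> par (lb x) e = par (lb y) e" if "e \<in> edges (lb x)" for e
    using induced[OF assms] that by (simp add: induced_substructure_def)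
  then show ?thesis by (simp add: embedding_def)
qed

text \<open>What \<open>hom_count\<close> becomes after grouping by projections at every level: the
  projection \<open>b\<close> replaces the embedding, and each fibre is replaced by its polynomial
  size.\<close>

fun shape_count :: "('s \<times> 'c) list set \<Rightarrow> shape \<Rightarrow> 'x \<Rightarrow> ('e \<Rightarrow> ('s \<times> 'c) list) \<Rightarrow>
    (('s \<times> 'c) list \<Rightarrow> nat) \<Rightarrow> int" where
  "shape_count U (Shape ss) x b n = (\<Prod>s\<leftarrow>ss. \<Sum>y\<in>ch x. \<Sum>c\<in>projections U (edges (lb x)) (lb y) b.
     extension_poly (edges (lb x)) (lb y) c n * shape_count U s y c n)"

lemma polylike_shape_count: "polylike (shape_count U s x b)"
proof (induction s arbitrary: x b)
  case (Shape ss)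
  have "polylike (\<lambda>n. \<Prod>s\<leftarrow>ss. \<Sum>y\<in>ch x. \<Sum>c\<in>projections U (edges (lb x)) (lb y) b.
     extension_poly (edges (lb x)) (lb y) c n * shape_count U s y c n)"
    by (intro polylike_prod_list polylike_sum polylike_mult Shape.IH
        extension_poly(1)[OF lb_etrees edges_ch par_ch])
  then show ?case by (simp add: fun_eq_iff[symmetric])
qed

lemma shape_count_cong:
  assumes "\<And>e. e \<in> edges (lb x) \<Longrightarrow> b e = b' e"
  shows "shape_count U s x b n = shape_count U s x b' n"
proof -
  have "projections U (edges (lb x)) B b = projections U (edges (lb x)) B b'" for B :: "('e, 's) etree"
    using assms by (auto simp: projections_def)
  then show ?thesis by (cases s) simp
qed

text \<open>Inductively, the count below a node depends on \<alpha> only through its projection,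
  which is what grouping by fibres requires at the next level.\<close>

lemma hom_count_blow_up:
  assumes U: "supported U n" "finite U"
    and "embedding (lb x) (blow_up n) \<alpha>" "\<And>e. e \<in> edges (lb x) \<Longrightarrow> map fst (\<alpha> e) = b e"
  shows "hom_count ch lb (blow_up n) s x \<alpha> = shape_count U s x b n"
  using assms(3-)
proof (induction s arbitrary: x \<alpha> b)
  case (Shape ss)
  have "(\<Sum>\<beta>\<in>extensions (edges (lb x)) (lb y) (blow_up n) \<alpha>. hom_count ch lb (blow_up n) s y \<beta>) =
      (\<Sum>c\<in>projections U (edges (lb x)) (lb y) b.
        extension_poly (edges (lb x)) (lb y) c n * shape_count U s y c n)"
    if s: "s \<in> set ss" and y: "y \<in> ch x" for s y
    using Shape.prems Shape.IH[OF s]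
    by (intro sum_extensions_blow_up[OF U lb_etrees edges_ch[OF y] par_ch[OF y]])
      (simp_all add: embedding_ch[OF y] embeddingsD(1))
  then have "(\<Sum>y\<in>ch x. \<Sum>\<beta>\<in>extensions (edges (lb x)) (lb y) (blow_up n) \<alpha>. hom_count ch lb (blow_up n) s y \<beta>) =
      (\<Sum>y\<in>ch x. \<Sum>c\<in>projections U (edges (lb x)) (lb y) b.
        extension_poly (edges (lb x)) (lb y) c n * shape_count U s y c n)"
    if "s \<in> set ss" for s
    using that by (intro sum.cong) auto
  then show ?case
    by (auto simp only: hom_count.simps shape_count.simps intro!: arg_cong[where f = prod_list] map_cong)
qed

end

section \<open>Linear independence of characters\<close>

text \<open>Dedekind's argument on the monoid of lists: translate the relation by \<open>zs\<close>
  and subtract \<open>\<psi> zs\<close> times the original. This removes \<open>\<psi>\<close>, so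
  by induction \<open>w \<phi> * (\<phi> zs - \<psi> zs)\<close> vanishes; choose \<open>zs\<close>
  where the two characters differ.\<close>

lemma independent_distinct_characters:
  fixes w :: "('m list \<Rightarrow> 'a::idom) \<Rightarrow> 'a"
  assumes "finite V" "\<And>\<phi> xs ys. \<phi> \<in> V \<Longrightarrow> \<phi> (xs @ ys) = \<phi> xs * \<phi> ys" "\<And>\<phi>. \<phi> \<in> V \<Longrightarrow> \<phi> [] = 1"
    and "\<And>xs. (\<Sum>\<phi>\<in>V. w \<phi> * \<phi> xs) = 0"
  shows "\<forall>\<phi>\<in>V. w \<phi> = 0"
  using assms
proof (induction V arbitrary: w rule: finite_induct)
  case (insert \<psi> V)
  have "\<forall>\<phi>\<in>V. w \<phi> * (\<phi> zs - \<psi> zs) = 0" for zs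
  proof (rule insert.IH)
    fix xs
    have "(\<Sum>\<phi>\<in>insert \<psi> V. w \<phi> * (\<phi> zs - \<psi> zs) * \<phi> xs) =
        (\<Sum>\<phi>\<in>insert \<psi> V. w \<phi> * \<phi> (zs @ xs)) - \<psi> zs * (\<Sum>\<phi>\<in>insert \<psi> V. w \<phi> * \<phi> xs)"
      unfolding sum_distrib_left sum_subtractf[symmetric]
      by (rule sum.cong[OF refl]) (simp only: insert.prems(1) algebra_simps)
    then have "(\<Sum>\<phi>\<in>insert \<psi> V. w \<phi> * (\<phi> zs - \<psi> zs) * \<phi> xs) = 0"
      using insert.prems(3) by simp
    then show "(\<Sum>\<phi>\<in>V. w \<phi> * (\<phi> zs - \<psi> zs) * \<phi> xs) = 0"
      using insert.hyps by simp
  qed (use insert.prems in auto)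
  moreover have "\<exists>zs. \<phi> zs \<noteq> \<psi> zs" if "\<phi> \<in> V" for \<phi>
    using that insert.hyps(2) by (metis ext)
  ultimately have "\<forall>\<phi>\<in>V. w \<phi> = 0" by fastforce
  moreover have "w \<psi> = 0"
    using calculation insert.prems(3)[of "[]"] insert.prems(2)[of \<psi>] insert.hyps by simp
  ultimately show ?case by simp
qed simp

text \<open>Members of the family may coincide as characters, so only the total weight of each class
  of equal ones must vanish.\<close>

lemma independent_characters:
  fixes \<chi> :: "'v \<Rightarrow> 'm list \<Rightarrow> 'a::idom"
  assumes "finite V" "\<And>v xs ys. v \<in> V \<Longrightarrow> \<chi> v (xs @ ys) = \<chi> v xs * \<chi> v ys" "\<And>v. v \<in> V \<Longrightarrow> \<chi> v [] = 1"
    and sum0: "\<And>xs. (\<Sum>v\<in>V. w v * \<chi> v xs) = 0" and "u \<in> V"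
  shows "(\<Sum>v\<in>{v\<in>V. \<chi> v = \<chi> u}. w v) = 0"
proof -
  have "\<forall>\<phi>\<in>\<chi> ` V. (\<Sum>v\<in>{v\<in>V. \<chi> v = \<phi>}. w v) = 0"
  proof (rule independent_distinct_characters)
    fix xs
    have "(\<Sum>\<phi>\<in>\<chi> ` V. (\<Sum>v\<in>{v\<in>V. \<chi> v = \<phi>}. w v) * \<phi> xs) =
        (\<Sum>\<phi>\<in>\<chi> ` V. \<Sum>v\<in>{v\<in>V. \<chi> v = \<phi>}. w v * \<chi> v xs)"
      unfolding sum_distrib_right by (intro sum.cong) auto
    also have "\<dots> = (\<Sum>v\<in>V. w v * \<chi> v xs)"
      using assms(1) by (intro sum.group) auto
    finally show "(\<Sum>\<phi>\<in>\<chi> ` V. (\<Sum>v\<in>{v\<in>V. \<chi> v = \<phi>}. w v) * \<phi> xs) = 0" using sum0 by simp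
  qed (use assms in auto)
  then show ?thesis using assms(5) by blast
qed

section \<open>Embeddings into list trees\<close>

text \<open>An embedding into the infinite tree of all nonempty lists, the common ambient space for
  every list tree that is built.\<close>

definition list_embedding :: "('e, 's) etree \<Rightarrow> ('e \<Rightarrow> ('s \<times> 'c) list) \<Rightarrow> bool" where
  "list_embedding B b \<longleftrightarrow> inj_on b (edges B) \<and>
    (\<forall>e\<in>edges B. b e \<noteq> [] \<and> fst (hd (b e)) = lab B e \<and> list_parent (b e) = b (par B e))"

abbreviation lift0 :: "'v list \<Rightarrow> ('v \<times> nat) list" where
  "lift0 \<equiv> map (\<lambda>v. (v, 0))"

lemma map_fst_lift0 [simp]: "map fst (lift0 xs) = xs"
  by (induction xs) auto

lemma inj_lift0: "inj_on lift0 S"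
  by (metis inj_on_inverseI map_fst_lift0)

text \<open>Copy number 0 of an edge is available as soon as its multiplicity is positive.\<close>

lemma embedding_lift0:
  assumes b: "list_embedding B b" and B: "par B ` edges B \<subseteq> edges B"
    and n: "\<And>e. e \<in> edges B \<Longrightarrow> n (b e) \<noteq> 0"
  shows "embedding B (blow_up n) (lift0 \<circ> b)"
proof -
  have adm: "\<forall>e\<in>edges B. b e = xs \<longrightarrow> admissible n (lift0 xs)" for xs
  proof (induction xs)
    case (Cons v xs)
    show ?case
    proof (intro ballI impI)
      fix e assume e: "e \<in> edges B" "b e = v # xs"
      have "admissible n (lift0 xs)"
      proof (cases "xs = []")
        case False
        then have "b (par B e) = xs"
          using b e by (auto simp: list_embedding_def list_parent_def dest: bspec[of _ _ e])
        then show ?thesis using Cons e(1) B by auto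
      qed simp
      then show "admissible n (lift0 (v # xs))"
        using n[OF e(1)] e(2) by (simp add: comp_def)
    qed
  qed simp
  have "inj_on (lift0 \<circ> b) (edges B)"
    using b by (auto simp: list_embedding_def intro: comp_inj_on inj_lift0)
  moreover have "admissible n (lift0 (b e))" if "e \<in> edges B" for e using that adm by blast
  ultimately show ?thesis
    using b by (auto simp: embedding_def list_embedding_def hd_map list_parent_map)
qed

text \<open>With multiplicities 0 and 1 the only copy number is 0, so nothing is duplicated.\<close>

lemma etree_isomorphism_lift0:
  assumes b: "list_embedding B b" and B: "par B ` edges B \<subseteq> edges B"
  shows "etree_isomorphism B (blow_up (\<lambda>u. of_bool (u \<in> b ` edges B))) (lift0 \<circ> b)"
proof -
  let ?n = "\<lambda>u. of_bool (u \<in> b ` edges B) :: nat"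
  have emb: "embedding B (blow_up ?n) (lift0 \<circ> b)"
    using assms by (intro embedding_lift0) auto
  have "xs \<in> (lift0 \<circ> b) ` edges B" if xs: "xs \<noteq> []" "admissible ?n xs" for xs
  proof -
    have fst: "map fst xs \<in> b ` edges B"
      using supportedD[of "b ` edges B" ?n xs] xs by (auto simp: supported_def)
    have "lift0 (map fst xs) = xs" if "admissible ?n xs" for xs
      using that by (induction ?n xs rule: admissible.induct) (auto simp: of_bool_def split: if_splits)
    from this[OF xs(2)] have xs_eq: "xs = lift0 (map fst xs)" ..
    from fst obtain e where "e \<in> edges B" "map fst xs = b e" by blast
    then have "xs = (lift0 \<circ> b) e" "e \<in> edges B" using xs_eq by (simp_all only: comp_apply)
    then show ?thesis by blast
  qed
  then have "edges (blow_up ?n) \<subseteq> (lift0 \<circ> b) ` edges B" by auto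
  then show ?thesis
    using emb unfolding etree_isomorphism_def bij_betw_def embedding_def by blast
qed

text \<open>The head of the list carries the tag of the edge itself, so injective tags suffice. The
  tags control which edges of different trees are identified in a common list tree.\<close>

lemma list_embedding_tagged_path:
  assumes t: "t \<in> etrees k \<Sigma>" and g: "inj_on g (edges t)"
  shows "list_embedding t (\<lambda>e. map (\<lambda>u. (lab t u, g u)) (path t e))"
proof -
  have "hd (map (\<lambda>u. (lab t u, g u)) (path t e)) = (lab t e, g e)" if "e \<in> edges t" for e
    by (subst path_rec[OF t that]) simp
  moreover have "path t e \<noteq> []" for e by (simp add: path_def)
  moreover have "list_parent (path t e) = path t (par t e)" if "e \<in> edges t" for e
    by (subst path_rec[OF t that]) (use path_rec[OF t that] in \<open>auto simp: list_parent_def path_def\<close>)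
  ultimately show ?thesis
    using g unfolding list_embedding_def
    by (auto simp: list_parent_map inj_on_def) (metis prod.inject)
qed

section \<open>Separating inequivalent nodes\<close>

lemma embedding_restrict_edges:
  assumes "embedding B t f" "A \<subseteq> edges B"
  shows "embedding (B\<lparr>edges := A\<rparr>) t f"
  using assms by (auto simp: embedding_def intro: inj_on_subset)

lemma fst_comp_pair_zero [simp]: "fst \<circ> (\<lambda>v. (v, 0::nat)) = (\<lambda>v. v)"
  by auto

lemma list_embedding_hd:
  assumes "list_embedding t f" "t \<in> etrees k \<Sigma>" "e \<in> edges t"
  shows "f e \<noteq> []" "fst (hd (f e)) \<in> \<Sigma>"
  using assms etreesD(2)[OF assms(2)] by (auto simp: list_embedding_def image_subset_iff)

context pattern_system
begin

text \<open>Inputs over \<open>nat\<close> represent all finite inputs, by \<open>nat_copy\<close>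
  and \<open>hom_count_iso\<close>.\<close>

definition node_equiv :: "'x \<Rightarrow> 'x \<Rightarrow> ('e \<Rightarrow> 'e) \<Rightarrow> bool" where
  "node_equiv x y \<sigma> \<longleftrightarrow> etree_isomorphism (lb x) (lb y) \<sigma> \<and>
    (\<forall>t\<in>etrees k \<Sigma>. \<forall>\<beta>\<in>embeddings (lb y) (t :: (nat, 's) etree). \<forall>s.
      hom_count ch lb t s x (\<beta> \<circ> \<sigma>) = hom_count ch lb t s y \<beta>)"

lemma hom_count_iso:
  assumes "etree_isomorphism t t' \<phi>" "t \<in> etrees k \<Sigma>" "\<alpha> ` edges (lb x) \<subseteq> edges t"
  shows "hom_count ch lb t' s x (\<phi> \<circ> \<alpha>) = hom_count ch lb t s x \<alpha>"
  using assms edges_ch by (intro hom_count_target_iso[OF lb_etrees] etreesD(3)[OF assms(2)]) auto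

lemma sum_extensions_iso:
  assumes iso: "etree_isomorphism t t' \<phi>" and t: "t \<in> etrees k \<Sigma>"
    and A: "A \<subseteq> edges (lb x)" "\<alpha> ` A \<subseteq> edges t"
  shows "(\<Sum>\<beta>\<in>extensions A (lb x) t \<alpha>. hom_count ch lb t s x \<beta>) =
    (\<Sum>\<beta>\<in>extensions A (lb x) t' (\<phi> \<circ> \<alpha>). hom_count ch lb t' s x \<beta>)"
proof -
  have "(\<Sum>\<beta>\<in>extensions A (lb x) t \<alpha>. hom_count ch lb t s x \<beta>) =
      (\<Sum>\<beta>\<in>extensions A (lb x) t \<alpha>. hom_count ch lb t' s x (restrict (\<phi> \<circ> \<beta>) (edges (lb x))))"
  proof (rule sum.cong[OF refl])
    fix \<beta> assume "\<beta> \<in> extensions A (lb x) t \<alpha>"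
    then have "\<beta> ` edges (lb x) \<subseteq> edges t" by (auto simp: extensions_def dest: embeddingsD(4))
    from hom_count_iso[OF iso t this]
    show "hom_count ch lb t s x \<beta> = hom_count ch lb t' s x (restrict (\<phi> \<circ> \<beta>) (edges (lb x)))"
      using hom_count_cong[of lb x "restrict (\<phi> \<circ> \<beta>) (edges (lb x))" "\<phi> \<circ> \<beta>" ch t' s] by simp
  qed
  also have "\<dots> = (\<Sum>\<beta>\<in>extensions A (lb x) t' (\<phi> \<circ> \<alpha>). hom_count ch lb t' s x \<beta>)"
    by (intro sum.reindex_bij_betw bij_betw_extensions_target[OF iso] etreesD(3)[OF t]
        etreesD(3)[OF lb_etrees] A)
  finally show ?thesis .
qed

text \<open>The children of two nodes will enter with weights 1 and -1, so a pair of opposite signs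
  is a pair of children to be matched. Compatibility with the maps \<tau> makes the new isomorphism
  extend the given one between the parents.\<close>

lemma opposite_equivalent:
  fixes \<epsilon> :: "'i \<Rightarrow> int" and nd :: "'i \<Rightarrow> 'x" and As :: "'i \<Rightarrow> 'e set"
    and \<tau> :: "'i \<Rightarrow> 'e \<Rightarrow> 'a" and A :: "('a, 's) etree"
  assumes I: "finite I" "I \<noteq> {}" and \<epsilon>: "\<And>i. i \<in> I \<Longrightarrow> \<epsilon> i \<noteq> 0"
    and A: "par A ` edges A \<subseteq> edges A"
    and As: "\<And>i. i \<in> I \<Longrightarrow> As i \<subseteq> edges (lb (nd i))"
      "\<And>i. i \<in> I \<Longrightarrow> par (lb (nd i)) ` As i \<subseteq> As i"
    and \<tau>: "\<And>i. i \<in> I \<Longrightarrow> etree_isomorphism ((lb (nd i))\<lparr>edges := As i\<rparr>) A (\<tau> i)"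
    and sum0: "\<And>(t :: (nat, 's) etree) \<alpha> s. t \<in> etrees k \<Sigma> \<Longrightarrow> embedding A t \<alpha> \<Longrightarrow>
      (\<Sum>i\<in>I. \<epsilon> i * (\<Sum>\<beta>\<in>extensions (As i) (lb (nd i)) t (\<alpha> \<circ> \<tau> i). hom_count ch lb t s (nd i) \<beta>)) = 0"
  shows "\<exists>i\<in>I. \<exists>j\<in>I. \<exists>\<sigma>. \<epsilon> i * \<epsilon> j < 0 \<and> (\<forall>e\<in>As i. \<sigma> e \<in> As j \<and> \<tau> j (\<sigma> e) = \<tau> i e) \<and>
    node_equiv (nd i) (nd j) \<sigma>"
proof (rule ccontr)
  assume no: "\<not> ?thesis"
  define B where "B i = lb (nd i)" for i
  have B: "B i \<in> etrees k \<Sigma>" for i by (simp add: B_def lb_etrees)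
  note finB = etreesD(1)[OF B] and closedB = etreesD(3)[OF B]
  note As = As[folded B_def] and \<tau> = \<tau>[folded B_def]
  \<comment> \<open>Any embedding of some \<open>B i\<close> into a copy of \<open>B z\<close> is
    then an isomorphism, by counting edges.\<close>
  obtain z where z: "z \<in> I" and min: "\<And>i. i \<in> I \<Longrightarrow> card (edges (B z)) \<le> card (edges (B i))"
    using arg_min_if_finite(1)[OF I, of "\<lambda>i. card (edges (B i))"]
      arg_min_least[OF I, of _ "\<lambda>i. card (edges (B i))"] by blast
  \<comment> \<open>The finitely many candidates that must be told apart from \<open>z\<close>: by
    the assumption \<open>no\<close>, none of these isomorphisms is an equivalence.\<close>
  define L where "L = {(j, \<sigma>). j \<in> I \<and> \<epsilon> j * \<epsilon> z < 0 \<and> \<sigma> \<in> embeddings (B j) (B z) \<and>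
    etree_isomorphism (B j) (B z) \<sigma> \<and> (\<forall>e\<in>As j. \<sigma> e \<in> As z \<and> \<tau> z (\<sigma> e) = \<tau> j e)}"
  have "L \<subseteq> Sigma I (\<lambda>j. embeddings (B j) (B z))" by (auto simp: L_def)
  then have finL: "finite L"
    by (rule finite_subset) (intro finite_SigmaI I(1) finite_embeddings finB)
  have ex: "\<exists>t \<beta> s. (t :: (nat, 's) etree) \<in> etrees k \<Sigma> \<and> \<beta> \<in> embeddings (B z) t \<and>
      hom_count ch lb t s (nd (fst l)) (\<beta> \<circ> snd l) \<noteq> hom_count ch lb t s (nd z) \<beta>" if "l \<in> L" for l
  proof -
    from that obtain j \<sigma> where l: "l = (j, \<sigma>)" "j \<in> I" "\<epsilon> j * \<epsilon> z < 0" "etree_isomorphism (B j) (B z) \<sigma>"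
      "\<forall>e\<in>As j. \<sigma> e \<in> As z \<and> \<tau> z (\<sigma> e) = \<tau> j e" by (auto simp: L_def)
    then have "\<not> node_equiv (nd j) (nd z) \<sigma>" using no z by blast
    then show "\<exists>t \<beta> s. (t :: (nat, 's) etree) \<in> etrees k \<Sigma> \<and> \<beta> \<in> embeddings (B z) t \<and>
        hom_count ch lb t s (nd (fst l)) (\<beta> \<circ> snd l) \<noteq> hom_count ch lb t s (nd z) \<beta>"
      using l(1,4) by (auto simp: node_equiv_def B_def)
  qed
  define Q where "Q l q \<longleftrightarrow> (case q of (t :: (nat, 's) etree, \<beta>, s) \<Rightarrow> t \<in> etrees k \<Sigma> \<and> \<beta> \<in> embeddings (B z) t \<and>
      hom_count ch lb t s (nd (fst l)) (\<beta> \<circ> snd l) \<noteq> hom_count ch lb t s (nd z) \<beta>)" for l q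
  define t \<beta> s where "t l = fst (SOME q. Q l q)" and "\<beta> l = fst (snd (SOME q. Q l q))"
    and "s l = snd (snd (SOME q. Q l q))" for l
  have Q: "Q l (t l, \<beta> l, s l)" if l: "l \<in> L" for l
  proof -
    obtain t' \<beta>' s' where "Q l (t', \<beta>', s')" using ex[OF l] unfolding Q_def by blast
    then have "Q l (SOME q. Q l q)" by (rule someI)
    then show ?thesis by (simp add: t_def \<beta>_def s_def)
  qed
  then have t: "t l \<in> etrees k \<Sigma>" and \<beta>: "\<beta> l \<in> embeddings (B z) (t l)"
    and distinct: "hom_count ch lb (t l) (s l) (nd (fst l)) (\<beta> l \<circ> snd l) \<noteq> hom_count ch lb (t l) (s l) (nd z) (\<beta> l)"
    if "l \<in> L" for l
    using that unfolding Q_def by auto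

  \<comment> \<open>Amalgamate the trees \<open>t l\<close> over \<open>B z\<close> in one list tree \<open>U\<close>.\<close>
  define g where "g l u = (if u \<in> \<beta> l ` edges (B z) then Inl (inv_into (edges (B z)) (\<beta> l) u)
    else Inr (l, u))" for l u
  define f where "f l e = map (\<lambda>u. (lab (t l) u, g l u)) (path (t l) e)" for l e
  define b :: "'e \<Rightarrow> ('s \<times> ('e + ('i \<times> ('e \<Rightarrow> 'e)) \<times> nat)) list"
    where "b e = map (\<lambda>u. (lab (B z) u, Inl u)) (path (B z) e)" for e
  have inj_g: "inj_on (g l) (edges (t l))" for l
  proof (rule inj_onI)
    fix u u' assume eq: "g l u = g l u'"
    show "u = u'"
    proof (cases "u \<in> \<beta> l ` edges (B z)"; cases "u' \<in> \<beta> l ` edges (B z)")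
      assume in_image: "u \<in> \<beta> l ` edges (B z)" "u' \<in> \<beta> l ` edges (B z)"
      with eq have "inv_into (edges (B z)) (\<beta> l) u = inv_into (edges (B z)) (\<beta> l) u'"
        by (simp only: g_def if_True sum.inject)
      then show ?thesis using in_image by (rule inv_into_injective)
    qed (use eq in \<open>simp_all only: g_def if_True if_False sum.inject sum.distinct prod.inject\<close>)
  qed
  have f: "list_embedding (t l) (f l)" if "l \<in> L" for l
    unfolding f_def using t[OF that] inj_g by (rule list_embedding_tagged_path)
  have b: "list_embedding (B z) b"
    unfolding b_def using B by (rule list_embedding_tagged_path) simp
  \<comment> \<open>Edges from \<open>B z\<close> get the shared tag \<open>Inl\<close>, all others
    a tag private to \<open>l\<close>. The path of an edge from \<open>B z\<close> stays inside the
    image of \<open>B z\<close>, so its list is the same for every \<open>l\<close>.\<close>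
  have fb: "f l (\<beta> l e) = b e" if l: "l \<in> L" and e: "e \<in> edges (B z)" for l e
  proof -
    note emb = embeddingsD[OF \<beta>[OF l]]
    have "map (\<lambda>u. (lab (t l) (\<beta> l u), g l (\<beta> l u))) (path (B z) e) =
        map (\<lambda>u. (lab (B z) u, Inl u)) (path (B z) e)"
    proof (rule map_cong[OF refl])
      fix u assume "u \<in> set (path (B z) e)"
      then have "u \<in> edges (B z)" using set_path[OF B e] by blast
      then show "(lab (t l) (\<beta> l u), g l (\<beta> l u)) = (lab (B z) u, Inl u)"
        using emb(3,5) by (simp add: g_def inv_into_f_f)
    qed
    then show ?thesis
      by (simp add: f_def b_def path_embedding[OF emb(1) B e] comp_def)
  qed
  define U where "U = b ` edges (B z) \<union> (\<Union>l\<in>L. f l ` edges (t l))"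
  have finU: "finite U" using finB finL etreesD(1)[OF t] by (auto simp: U_def)
  have U: "u \<noteq> [] \<and> length u \<le> k \<and> fst (hd u) \<in> \<Sigma>" if "u \<in> U" for u
  proof -
    from that consider e where "e \<in> edges (B z)" "u = b e"
      | l e where "l \<in> L" "e \<in> edges (t l)" "u = f l e"
      unfolding U_def by blast
    then show ?thesis
    proof cases
      case 1
      then show ?thesis
        using list_embedding_hd[OF b B 1(1)] length_path[OF B 1(1)] by (simp add: b_def)
    next
      case 2
      then show ?thesis
        using list_embedding_hd[OF f[OF 2(1)] t[OF 2(1)] 2(2)] length_path[OF t[OF 2(1)] 2(2)]
        by (simp add: f_def)
    qed
  qed
  \<comment> \<open>The multiplicities that live on \<open>U\<close> and keep \<open>B z\<close>
    present. This set is closed under curves.\<close>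
  define N where "N = {n. supported U n \<and> (\<forall>e\<in>edges (B z). n (b e) \<noteq> 0)}"
  have etree_N: "blow_up n \<in> etrees k \<Sigma>" and supp_N: "supported U n" if "n \<in> N" for n
  proof -
    show supp: "supported U n" using that by (simp add: N_def)
    then have "finite {e. n e \<noteq> 0}" using finU by (auto simp: supported_def intro: finite_subset[of _ U])
    then show "blow_up n \<in> etrees k \<Sigma>"
      using supp U by (intro blow_up_etrees) (auto simp: supported_def)
  qed
  have emb_b: "embedding (B z) (blow_up n) (lift0 \<circ> b)" if "n \<in> N" for n
    using that by (intro embedding_lift0[OF b closedB]) (auto simp: N_def)
  have curve_N: "curve n n' X \<in> N" if "n \<in> N" "n' \<in> N" for n n' X
    using that unfolding N_def supported_def mem_Collect_eq curve_eq_0_iff by auto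
  define n\<^sub>0 where "n\<^sub>0 = (\<lambda>u. of_bool (u \<in> b ` edges (B z)) :: nat)"
  have n\<^sub>0: "n\<^sub>0 \<in> N" by (auto simp: n\<^sub>0_def N_def U_def supported_def)

  \<comment> \<open>A blow-up in which all the distinctions made by the trees \<open>t l\<close> persist.\<close>
  define D where "D l n = shape_count U (s l) (nd (fst l)) (b \<circ> snd l) n - shape_count U (s l) (nd z) b n" for l n
  \<comment> \<open>Multiplicity 1 on the edges of \<open>t l\<close> makes the blow-up a copy of
    \<open>t l\<close>, which was chosen to show the difference.\<close>
  have "\<exists>n\<in>N. D l n \<noteq> 0" if l: "l \<in> L" for l
  proof
    let ?n = "\<lambda>u. of_bool (u \<in> f l ` edges (t l)) :: nat"
    let ?\<psi> = "lift0 \<circ> f l"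
    note \<beta>l = embeddingsD[OF \<beta>[OF l]]
    have "b ` edges (B z) \<subseteq> f l ` edges (t l)"
      using fb[OF l] \<beta>l(4) by (metis image_eqI image_subsetI)
    then show n: "?n \<in> N" using l by (auto simp: N_def U_def supported_def)
    have iso: "etree_isomorphism (t l) (blow_up ?n) ?\<psi>"
      using etree_isomorphism_lift0[OF f[OF l] etreesD(3)[OF t[OF l]]] .
    have embl: "embedding (B z) (blow_up ?n) (?\<psi> \<circ> \<beta> l)"
      using embedding_comp[OF \<beta>l(1) etree_isomorphism_embedding[OF iso] closedB] .
    have \<sigma>: "embedding (B (fst l)) (B z) (snd l)" "etree_isomorphism (B (fst l)) (B z) (snd l)"
      using l by (auto simp: L_def dest: etree_isomorphism_embedding)
    have \<sigma>_in: "snd l e \<in> edges (B z)" if "e \<in> edges (B (fst l))" for e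
      using \<sigma>(1) that by (auto simp: embedding_def)
    have "shape_count U (s l) (nd z) b ?n = hom_count ch lb (blow_up ?n) (s l) (nd z) (?\<psi> \<circ> \<beta> l)"
      using fb[OF l] embl
      by (intro hom_count_blow_up[OF supp_N[OF n] finU, symmetric]) (simp_all add: B_def)
    also have "\<dots> = hom_count ch lb (t l) (s l) (nd z) (\<beta> l)"
      using \<beta>l(4) by (intro hom_count_iso[OF iso t[OF l]]) (auto simp: B_def)
    finally have 1: "shape_count U (s l) (nd z) b ?n = hom_count ch lb (t l) (s l) (nd z) (\<beta> l)" .
    have "shape_count U (s l) (nd (fst l)) (b \<circ> snd l) ?n =
        hom_count ch lb (blow_up ?n) (s l) (nd (fst l)) ((?\<psi> \<circ> \<beta> l) \<circ> snd l)"
      using fb[OF l \<sigma>_in] embedding_comp[OF \<sigma>(1) embl closedB]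
      by (intro hom_count_blow_up[OF supp_N[OF n] finU, symmetric]) (simp_all add: B_def)
    also have "\<dots> = hom_count ch lb (t l) (s l) (nd (fst l)) (\<beta> l \<circ> snd l)"
    proof -
      have "(\<beta> l \<circ> snd l) ` edges (lb (nd (fst l))) \<subseteq> edges (t l)"
        using \<beta>l(4) \<sigma>_in by (auto simp: B_def)
      from hom_count_iso[OF iso t[OF l] this] show ?thesis by (simp only: comp_assoc)
    qed
    finally show "D l ?n \<noteq> 0" using 1 distinct[OF l] by (simp add: D_def)
  qed
  then have "\<exists>n\<in>N. \<forall>l\<in>L. D l n \<noteq> 0"
    using n\<^sub>0 curve_N unfolding D_def
    by (intro polylike_common_nonzero finL polylike_diff polylike_shape_count) auto
  then obtain n\<^sub>1 where n\<^sub>1: "n\<^sub>1 \<in> N" "\<And>l. l \<in> L \<Longrightarrow> D l n\<^sub>1 \<noteq> 0"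
    by blast

  \<comment> \<open>A single embedding of \<open>A\<close> for all \<open>n\<close> in
    \<open>N\<close>, since it uses copy 0 only. Its projection, and with it the index set
    \<open>V\<close> below, does not depend on \<open>n\<close>.\<close>
  define \<alpha> where "\<alpha> = (lift0 \<circ> b) \<circ> inv_into (As z) (\<tau> z)"
  define b\<^sub>A where "b\<^sub>A i = b \<circ> (inv_into (As z) (\<tau> z) \<circ> \<tau> i)" for i
  have iso_z: "bij_betw (\<tau> z) (As z) (edges A)" "etree_isomorphism A ((B z)\<lparr>edges := As z\<rparr>) (inv_into (As z) (\<tau> z))"
    using \<tau>[OF z] etree_isomorphism_inv[OF \<tau>[OF z]] As[OF z] by (simp_all add: etree_isomorphism_def)
  have emb_\<alpha>: "embedding A (blow_up n) \<alpha>" if "n \<in> N" for n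
    unfolding \<alpha>_def
    by (rule embedding_comp[OF etree_isomorphism_embedding[OF iso_z(2)]
          embedding_restrict_edges[OF emb_b[OF that] As(1)[OF z]] A])
  have emb_\<alpha>\<tau>: "embedding ((B i)\<lparr>edges := As i\<rparr>) (blow_up n) (\<alpha> \<circ> \<tau> i)" if "n \<in> N" "i \<in> I" for n i
    using embedding_comp[OF etree_isomorphism_embedding[OF \<tau>[OF that(2)]] emb_\<alpha>[OF that(1)]] As(2)[OF that(2)]
    by simp
  have \<tau>_in: "\<tau> i e \<in> edges A" if "i \<in> I" "e \<in> As i" for i e
    using \<tau>[OF that(1)] that(2) by (auto simp: etree_isomorphism_def bij_betw_def)
  define W where "W i c = (\<lambda>n. \<epsilon> i * extension_poly (As i) (B i) c n)"
    for i and c :: "'e \<Rightarrow> ('s \<times> ('e + ('i \<times> ('e \<Rightarrow> 'e)) \<times> nat)) list"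
  have sum_N: "(\<Sum>i\<in>I. \<Sum>c\<in>projections U (As i) (B i) (b\<^sub>A i). W i c n * shape_count U s (nd i) c n) = 0"
    if n: "n \<in> N" for n s
  proof -
    \<comment> \<open>\<open>sum0\<close> speaks of inputs over \<open>nat\<close>, so it is applied
      to a copy of the blow-up.\<close>
    obtain t :: "(nat, 's) etree" and \<phi> where t: "etree_isomorphism (blow_up n) t \<phi>" "t \<in> etrees k \<Sigma>"
      using nat_copy[OF etree_N[OF n]] .
    have "(\<Sum>c\<in>projections U (As i) (B i) (b\<^sub>A i). extension_poly (As i) (B i) c n * shape_count U s (nd i) c n) =
        (\<Sum>\<beta>\<in>extensions (As i) (lb (nd i)) t ((\<phi> \<circ> \<alpha>) \<circ> \<tau> i). hom_count ch lb t s (nd i) \<beta>)" if i: "i \<in> I" for i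
    proof -
      have "(\<Sum>c\<in>projections U (As i) (B i) (b\<^sub>A i). extension_poly (As i) (B i) c n * shape_count U s (nd i) c n) =
          (\<Sum>\<beta>\<in>extensions (As i) (B i) (blow_up n) (\<alpha> \<circ> \<tau> i). hom_count ch lb (blow_up n) s (nd i) \<beta>)"
        using emb_\<alpha>\<tau>[OF n i] hom_count_blow_up[OF supp_N[OF n] finU, of "nd i"]
        by (intro sum_extensions_blow_up[OF supp_N[OF n] finU B As(1)[OF i] As(2)[OF i], symmetric])
          (auto simp: b\<^sub>A_def \<alpha>_def B_def dest: embeddingsD(1))
      also have "\<dots> = (\<Sum>\<beta>\<in>extensions (As i) (lb (nd i)) t ((\<phi> \<circ> \<alpha>) \<circ> \<tau> i). hom_count ch lb t s (nd i) \<beta>)"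
      proof -
        have "(\<alpha> \<circ> \<tau> i) ` As i \<subseteq> edges (blow_up n)"
          using emb_\<alpha>\<tau>[OF n i] by (simp add: embedding_def del: blow_up_simps)
        from sum_extensions_iso[OF t(1) etree_N[OF n] As(1)[OF i, unfolded B_def] this]
        show ?thesis by (simp only: B_def comp_assoc)
      qed
      finally show ?thesis .
    qed
    then have "(\<Sum>i\<in>I. \<epsilon> i * (\<Sum>c\<in>projections U (As i) (B i) (b\<^sub>A i).
        extension_poly (As i) (B i) c n * shape_count U s (nd i) c n)) = 0"
      using sum0[OF t(2), of "\<phi> \<circ> \<alpha>" s]
        embedding_comp[OF emb_\<alpha>[OF n] etree_isomorphism_embedding[OF t(1)] A] by simp
    then show ?thesis by (simp add: W_def sum_distrib_left mult.assoc)
  qed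

  \<comment> \<open>Along the curve from \<open>n\<^sub>0\<close> to \<open>n\<^sub>1\<close> the counts are characters with values in \<open>int poly\<close>.\<close>
  define V where "V = Sigma I (\<lambda>i. projections U (As i) (B i) (b\<^sub>A i))"
  have finV: "finite V"
    unfolding V_def using I(1) finite_projections[OF finU finB] by (intro finite_SigmaI) auto
  have "\<forall>v\<in>V. \<exists>p. \<forall>X. W (fst v) (snd v) (curve n\<^sub>0 n\<^sub>1 X) = poly p (int X)"
  proof
    fix v assume "v \<in> V"
    then have "fst v \<in> I" by (auto simp: V_def)
    then have "polylike (W (fst v) (snd v))"
      unfolding W_def by (intro polylike_mult polylike_const extension_poly(1)[OF B] As)
    then show "\<exists>p. \<forall>X. W (fst v) (snd v) (curve n\<^sub>0 n\<^sub>1 X) = poly p (int X)"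
      by (auto simp: polylike_def)
  qed
  then obtain PW where PW: "\<And>v X. v \<in> V \<Longrightarrow> W (fst v) (snd v) (curve n\<^sub>0 n\<^sub>1 X) = poly (PW v) (int X)"
    by metis
  have "\<forall>v ss. \<exists>p. \<forall>X. shape_count U (Shape ss) (nd (fst v)) (snd v) (curve n\<^sub>0 n\<^sub>1 X) = poly p (int X)"
    using polylike_shape_count unfolding polylike_def by blast
  then obtain PC where PC: "\<And>v ss X.
      shape_count U (Shape ss) (nd (fst v)) (snd v) (curve n\<^sub>0 n\<^sub>1 X) = poly (PC v ss) (int X)"
    by metis
  \<comment> \<open>The term of \<open>B z\<close> embedded by its own copy in \<open>U\<close>; its
    weight must not cancel.\<close>
  define u where "u = (z, restrict b (edges (B z)))"
  have b\<^sub>A_z: "b\<^sub>A z e = b e" if "e \<in> As z" for e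
    using iso_z(1) that by (simp add: b\<^sub>A_def bij_betw_def inv_into_f_f)
  have u: "u \<in> V"
    using z As(1)[OF z] b\<^sub>A_z by (auto simp: u_def V_def projections_def U_def)
  have "(\<Sum>v\<in>{v\<in>V. PC v = PC u}. PW v) = 0"
  proof (rule independent_characters[OF finV _ _ _ u])
    show "PC v (xs @ ys) = PC v xs * PC v ys" for v xs ys
      by (rule poly_eq_of_nat) (simp flip: PC)
    show "PC v [] = 1" for v
      by (rule poly_eq_of_nat) (simp flip: PC)
    show "(\<Sum>v\<in>V. PW v * PC v ss) = 0" for ss
    proof (rule poly_eq_of_nat)
      fix X :: nat
      have "poly (\<Sum>v\<in>V. PW v * PC v ss) (int X) = (\<Sum>v\<in>V. W (fst v) (snd v) (curve n\<^sub>0 n\<^sub>1 X) *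
          shape_count U (Shape ss) (nd (fst v)) (snd v) (curve n\<^sub>0 n\<^sub>1 X))"
        unfolding poly_sum poly_mult by (intro sum.cong refl) (simp only: PW PC)
      also have "\<dots> = 0"
        unfolding V_def using sum_N[OF curve_N[OF n\<^sub>0 n\<^sub>1(1)]] I(1) finite_projections[OF finU finB]
        by (subst sum.Sigma[symmetric, where g = "\<lambda>i c. W i c (curve n\<^sub>0 n\<^sub>1 X) *
          shape_count U (Shape ss) (nd i) c (curve n\<^sub>0 n\<^sub>1 X)", unfolded split_beta])
          (auto simp del: shape_count.simps)
      finally show "poly (\<Sum>v\<in>V. PW v * PC v ss) (int X) = poly 0 (int X)" by simp
    qed
  qed
  \<comment> \<open>At \<open>X = 0\<close> the curve is at \<open>n\<^sub>0\<close>, where the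
    weights count extensions into the copy of \<open>B z\<close>. The class of characters equal to
    \<open>PC u\<close> was determined by whole polynomials.\<close>
  then have "poly (\<Sum>v\<in>{v\<in>V. PC v = PC u}. PW v) (int 0) = 0" by simp
  then have "(\<Sum>v\<in>{v\<in>V. PC v = PC u}. W (fst v) (snd v) n\<^sub>0) = 0"
    using PW[of _ 0] by (simp add: poly_sum)
  then have sum_n\<^sub>0: "(\<Sum>v\<in>{v\<in>V. PC v = PC u}. \<epsilon> z * W (fst v) (snd v) n\<^sub>0) = 0"
    by (simp flip: sum_distrib_left)

  have card_n\<^sub>0: "extension_poly (As i) (B i) c n\<^sub>0 = int (card (extensions_over (As i) (B i) c n\<^sub>0 (\<alpha> \<circ> \<tau> i)))"
    if "(i, c) \<in> V" for i c
    using that emb_\<alpha>\<tau>[OF n\<^sub>0]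
    by (intro extension_poly(2)[OF B As finite_edges_blow_up[OF supp_N[OF n\<^sub>0] finU], symmetric])
      (auto simp: V_def projections_def b\<^sub>A_def \<alpha>_def)
  have iso_n\<^sub>0: "etree_isomorphism (B z) (blow_up n\<^sub>0) (lift0 \<circ> b)"
    unfolding n\<^sub>0_def using etree_isomorphism_lift0[OF b closedB] .

  \<comment> \<open>\<open>blow_up n\<^sub>0\<close> is a copy of \<open>B z\<close>, so by minimality of \<open>B z\<close> only isomorphisms contribute.\<close>
  have nonneg: "0 \<le> \<epsilon> z * W (fst v) (snd v) n\<^sub>0" if v: "v \<in> V" "PC v = PC u" for v
  proof (rule ccontr)
    assume neg: "\<not> 0 \<le> \<epsilon> z * W (fst v) (snd v) n\<^sub>0"
    obtain i c where ic: "v = (i, c)" by force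
    have i: "i \<in> I" using v ic by (simp add: V_def)
    let ?E = "extensions_over (As i) (B i) c n\<^sub>0 (\<alpha> \<circ> \<tau> i)"
    have *: "\<not> 0 \<le> (\<epsilon> i * \<epsilon> z) * int (card ?E)"
      using neg card_n\<^sub>0 v(1) ic by (simp add: W_def mult_ac)
    then have sign: "\<epsilon> i * \<epsilon> z < 0" by (meson mult_nonneg_nonneg not_less of_nat_0_le_iff)
    from * have "?E \<noteq> {}" by (metis card.empty mult_zero_right of_nat_0 order_refl)
    then obtain \<gamma> where \<gamma>: "\<gamma> \<in> ?E" by blast
    have \<gamma>emb: "embedding (B i) (blow_up n\<^sub>0) \<gamma>"
      using \<gamma> by (auto simp: extensions_over_def extensions_def dest: embeddingsD(1))
    define \<sigma> where "\<sigma> = restrict (inv_into (edges (B z)) (lift0 \<circ> b) \<circ> \<gamma>) (edges (B i))"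
    have \<sigma>: "\<sigma> \<in> embeddings (B i) (B z)"
      unfolding \<sigma>_def
      by (intro restrict_in_embeddings embedding_comp[OF \<gamma>emb] closedB
          etree_isomorphism_embedding[OF etree_isomorphism_inv[OF iso_n\<^sub>0]])
    have "bij_betw \<sigma> (edges (B i)) (edges (B z))"
    proof -
      have "inj_on \<sigma> (edges (B i))" "\<sigma> ` edges (B i) \<subseteq> edges (B z)"
        using embeddingsD(3,4)[OF \<sigma>] by auto
      moreover from this have "\<sigma> ` edges (B i) = edges (B z)"
        using min[OF i] finB by (intro card_seteq) (simp_all add: card_image)
      ultimately show ?thesis by (simp add: bij_betw_def)
    qed
    then have \<sigma>_iso: "etree_isomorphism (B i) (B z) \<sigma>"
      using embeddingsD(5,6)[OF \<sigma>] by (simp add: etree_isomorphism_def)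
    have \<gamma>_eq: "\<gamma> e = lift0 (b (\<sigma> e))" if e: "e \<in> edges (B i)" for e
    proof -
      have "\<gamma> e \<in> (lift0 \<circ> b) ` edges (B z)"
        using \<gamma>emb e iso_n\<^sub>0 by (auto simp: embedding_def etree_isomorphism_def bij_betw_def)
      then have "(lift0 \<circ> b) (inv_into (edges (B z)) (lift0 \<circ> b) (\<gamma> e)) = \<gamma> e"
        by (rule f_inv_into_f)
      then show ?thesis using e by (simp add: \<sigma>_def)
    qed
    have inj_b: "inj_on b (edges (B z))" using b by (simp add: list_embedding_def)
    \<comment> \<open>\<gamma> extends \<open>\<alpha> \<circ> \<tau> i\<close>, and \<alpha> passes
      through the inverse of \<open>\<tau> z\<close>.\<close>
    have "\<sigma> e \<in> As z \<and> \<tau> z (\<sigma> e) = \<tau> i e" if e: "e \<in> As i" for e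
    proof -
      define e' where "e' = inv_into (As z) (\<tau> z) (\<tau> i e)"
      have e': "e' \<in> As z" "\<tau> z e' = \<tau> i e"
        using iso_z(1) \<tau>_in[OF i e] by (auto simp: e'_def bij_betw_def inv_into_into f_inv_into_f)
      have eB: "e \<in> edges (B i)" using As(1)[OF i] e by blast
      have "\<gamma> e = lift0 (b e')" using \<gamma> e by (simp add: extensions_over_def extensions_def \<alpha>_def e'_def)
      then have "lift0 (b (\<sigma> e)) = lift0 (b e')" using \<gamma>_eq[OF eB] by simp
      then have "b (\<sigma> e) = b e'" using inj_onD[OF inj_lift0[of UNIV]] by blast
      then have "\<sigma> e = e'"
        using inj_b embeddingsD(4)[OF \<sigma> eB] e'(1) As(1)[OF z] by (meson inj_onD subsetD)
      then show ?thesis using e' by simp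
    qed
    then have "(i, \<sigma>) \<in> L" using i sign \<sigma> \<sigma>_iso by (simp add: L_def)
    from n\<^sub>1(2)[OF this] have neq: "shape_count U (s (i, \<sigma>)) (nd i) (b \<circ> \<sigma>) n\<^sub>1 \<noteq>
        shape_count U (s (i, \<sigma>)) (nd z) b n\<^sub>1"
      by (simp add: D_def)
    obtain ss where ss: "s (i, \<sigma>) = Shape ss" by (cases "s (i, \<sigma>)")
    have "c e = b (\<sigma> e)" if "e \<in> edges (B i)" for e
    proof -
      have "c e = map fst (\<gamma> e)" using \<gamma> that by (simp add: extensions_over_def)
      then show ?thesis using \<gamma>_eq[OF that] by simp
    qed
    \<comment> \<open>On its domain \<open>c\<close> is \<open>b \<circ> \<sigma>\<close>. Equal
      characters, evaluated at \<open>X = 1\<close>, that is at \<open>n\<^sub>1\<close>, contradict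
      the choice of \<open>n\<^sub>1\<close>.\<close>
    then have "shape_count U (Shape ss) (nd i) (b \<circ> \<sigma>) n\<^sub>1 = shape_count U (Shape ss) (nd i) c n\<^sub>1"
      by (intro shape_count_cong) (simp add: B_def)
    also have "\<dots> = poly (PC v ss) 1" using PC[of ss v 1] ic by simp
    also have "\<dots> = poly (PC u ss) 1" using v(2) by simp
    also have "\<dots> = shape_count U (Shape ss) (nd z) (restrict b (edges (B z))) n\<^sub>1"
      using PC[of ss u 1] by (simp add: u_def)
    also have "\<dots> = shape_count U (Shape ss) (nd z) b n\<^sub>1"
      by (intro shape_count_cong) (simp add: B_def)
    finally show False using neq ss by simp
  qed
  have "\<epsilon> z * W (fst u) (snd u) n\<^sub>0 = 0"
  proof -
    have "finite {v\<in>V. PC v = PC u}" using finV by simp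
    then have "\<forall>v\<in>{v\<in>V. PC v = PC u}. \<epsilon> z * W (fst v) (snd v) n\<^sub>0 = 0"
      using sum_nonneg_eq_0_iff[of _ "\<lambda>v. \<epsilon> z * W (fst v) (snd v) n\<^sub>0"] nonneg sum_n\<^sub>0 by blast
    then show ?thesis using u by blast
  qed
  \<comment> \<open>The identity of \<open>B z\<close>, seen in its copy, is one of the extensions
    counted by the weight of \<open>u\<close>.\<close>
  moreover have "extensions_over (As z) (B z) (restrict b (edges (B z))) n\<^sub>0 (\<alpha> \<circ> \<tau> z) \<noteq> {}"
  proof -
    have "restrict (lift0 \<circ> b) (edges (B z)) \<in> embeddings (B z) (blow_up n\<^sub>0)"
      by (intro restrict_in_embeddings emb_b[OF n\<^sub>0] closedB)
    moreover have "b e = b (inv_into (As z) (\<tau> z) (\<tau> z e))" if "e \<in> As z" for e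
      using b\<^sub>A_z[OF that] by (simp add: b\<^sub>A_def)
    ultimately have "restrict (lift0 \<circ> b) (edges (B z)) \<in>
        extensions_over (As z) (B z) (restrict b (edges (B z))) n\<^sub>0 (\<alpha> \<circ> \<tau> z)"
      using As(1)[OF z] by (auto simp: extensions_over_def extensions_def \<alpha>_def)
    then show ?thesis by blast
  qed
  moreover have "finite (extensions_over (As z) (B z) (restrict b (edges (B z))) n\<^sub>0 (\<alpha> \<circ> \<tau> z))"
    using finite_extensions[OF finB finite_edges_blow_up[OF supp_N[OF n\<^sub>0] finU]]
    by (simp add: extensions_over_def)
  ultimately show False
    using card_n\<^sub>0[of z "restrict b (edges (B z))"] u \<epsilon>[OF z] by (simp add: W_def u_def)
qed

end

section \<open>Matching equivalent nodes\<close>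

context pattern_system
begin

lemma node_equiv_sym:
  assumes "node_equiv x y \<sigma>"
  shows "node_equiv y x (inv_into (edges (lb x)) \<sigma>)"
  unfolding node_equiv_def
proof (intro conjI ballI allI)
  let ?\<sigma>' = "inv_into (edges (lb x)) \<sigma>"
  note closed = etreesD(3)[OF lb_etrees]
  have iso: "etree_isomorphism (lb x) (lb y) \<sigma>" using assms by (simp add: node_equiv_def)
  then show iso': "etree_isomorphism (lb y) (lb x) ?\<sigma>'" using closed by (rule etree_isomorphism_inv)
  fix t :: "(nat, 's) etree" and \<beta> s
  assume t: "t \<in> etrees k \<Sigma>" and \<beta>: "\<beta> \<in> embeddings (lb x) t"
  let ?\<beta>' = "restrict (\<beta> \<circ> ?\<sigma>') (edges (lb y))"
  have "?\<beta>' \<in> embeddings (lb y) t"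
    by (intro restrict_in_embeddings closed
        embedding_comp[OF etree_isomorphism_embedding[OF iso'] embeddingsD(1)[OF \<beta>]])
  then have "hom_count ch lb t s x (?\<beta>' \<circ> \<sigma>) = hom_count ch lb t s y ?\<beta>'"
    using assms t by (simp add: node_equiv_def)
  moreover have "hom_count ch lb t s x (?\<beta>' \<circ> \<sigma>) = hom_count ch lb t s x \<beta>"
    using iso by (intro hom_count_cong) (auto simp: etree_isomorphism_def bij_betw_def inv_into_f_f)
  moreover have "hom_count ch lb t s y ?\<beta>' = hom_count ch lb t s y (\<beta> \<circ> ?\<sigma>')"
    by (intro hom_count_cong) simp
  ultimately show "hom_count ch lb t s y (\<beta> \<circ> ?\<sigma>') = hom_count ch lb t s x \<beta>" by simp
qed

text \<open>A matched pair contributes equally to both sides, so it can be cancelled from the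
  identity.\<close>

lemma sum_extensions_equiv:
  assumes equiv: "node_equiv c d \<sigma>'" and c: "c \<in> ch x"
    and iso: "etree_isomorphism (lb x) (lb y) \<sigma>"
    and ext: "\<And>e. e \<in> edges (lb x) \<Longrightarrow> \<sigma>' e = \<sigma> e"
    and t: "(t :: (nat, 's) etree) \<in> etrees k \<Sigma>"
  shows "(\<Sum>\<beta>\<in>extensions (edges (lb x)) (lb c) t (\<alpha> \<circ> \<sigma>). hom_count ch lb t s c \<beta>) =
    (\<Sum>\<beta>\<in>extensions (edges (lb y)) (lb d) t \<alpha>. hom_count ch lb t s d \<beta>)"
proof -
  have iso': "etree_isomorphism (lb c) (lb d) \<sigma>'" using equiv by (simp add: node_equiv_def)
  have "\<sigma>' ` edges (lb x) = edges (lb y)"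
    using iso ext by (auto simp: etree_isomorphism_def bij_betw_def)
  then have bij: "bij_betw (\<lambda>\<beta>. restrict (\<beta> \<circ> \<sigma>') (edges (lb c))) (extensions (edges (lb y)) (lb d) t \<alpha>)
      (extensions (edges (lb x)) (lb c) t (\<alpha> \<circ> \<sigma>))"
    using bij_betw_extensions_source[OF iso' etreesD(3)[OF lb_etrees] edges_ch[OF c], of \<alpha> "\<alpha> \<circ> \<sigma>" t] ext
    by simp
  have "(\<Sum>\<beta>\<in>extensions (edges (lb x)) (lb c) t (\<alpha> \<circ> \<sigma>). hom_count ch lb t s c \<beta>) =
      (\<Sum>\<beta>\<in>extensions (edges (lb y)) (lb d) t \<alpha>. hom_count ch lb t s c (restrict (\<beta> \<circ> \<sigma>') (edges (lb c))))"
    by (rule sum.reindex_bij_betw[OF bij, symmetric])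
  also have "\<dots> = (\<Sum>\<beta>\<in>extensions (edges (lb y)) (lb d) t \<alpha>. hom_count ch lb t s d \<beta>)"
  proof (rule sum.cong[OF refl])
    fix \<beta> assume "\<beta> \<in> extensions (edges (lb y)) (lb d) t \<alpha>"
    then have "hom_count ch lb t s c (\<beta> \<circ> \<sigma>') = hom_count ch lb t s d \<beta>"
      using equiv t by (simp add: node_equiv_def extensions_def)
    then show "hom_count ch lb t s c (restrict (\<beta> \<circ> \<sigma>') (edges (lb c))) = hom_count ch lb t s d \<beta>"
      using hom_count_cong[of lb c "restrict (\<beta> \<circ> \<sigma>') (edges (lb c))" "\<beta> \<circ> \<sigma>'" ch t s] by simp
  qed
  finally show ?thesis .
qed

text \<open>Subsets \<open>C\<close> and \<open>D\<close> are allowed so that a matched pair can be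
  removed and the induction continued. Opposite signs force one member from each side, so neither
  set can run out before the other.\<close>

lemma matching_of_equal_sums:
  assumes iso: "etree_isomorphism (lb x) (lb y) \<sigma>"
    and "C \<subseteq> ch x" "D \<subseteq> ch y"
    and "\<And>(t :: (nat, 's) etree) \<alpha> s. t \<in> etrees k \<Sigma> \<Longrightarrow> embedding (lb y) t \<alpha> \<Longrightarrow>
      (\<Sum>c\<in>C. \<Sum>\<beta>\<in>extensions (edges (lb x)) (lb c) t (\<alpha> \<circ> \<sigma>). hom_count ch lb t s c \<beta>) =
      (\<Sum>d\<in>D. \<Sum>\<beta>\<in>extensions (edges (lb y)) (lb d) t \<alpha>. hom_count ch lb t s d \<beta>)"
  shows "\<exists>\<pi> \<sigma>'. bij_betw \<pi> C D \<and>
    (\<forall>c\<in>C. node_equiv c (\<pi> c) (\<sigma>' c) \<and> (\<forall>e\<in>edges (lb x). \<sigma>' c e = \<sigma> e))"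
  using assms(2-)
proof (induction "card C" arbitrary: C D rule: less_induct)
  case less
  have finC: "finite C" and finD: "finite D"
    using less.prems(1,2) finite_ch by (auto intro: finite_subset)
  show ?case
  proof (cases "C = {} \<and> D = {}")
    case True
    then show ?thesis by (auto simp: bij_betw_def)
  next
    case False
    \<comment> \<open>The labels of both parents are identified with that of \<open>y\<close>: by
      \<sigma> for the children of \<open>x\<close>, by the identity for those of
      \<open>y\<close>.\<close>
    define As where "As = case_sum (\<lambda>_ :: 'x. edges (lb x)) (\<lambda>_ :: 'x. edges (lb y))"
    define \<tau> where "\<tau> = case_sum (\<lambda>_ :: 'x. \<sigma>) (\<lambda>_ :: 'x. id)"
    define \<epsilon> where "\<epsilon> = case_sum (\<lambda>_ :: 'x. 1 :: int) (\<lambda>_ :: 'x. - 1)"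
    have "\<exists>i\<in>C <+> D. \<exists>j\<in>C <+> D. \<exists>\<sigma>. \<epsilon> i * \<epsilon> j < 0 \<and>
      (\<forall>e\<in>As i. \<sigma> e \<in> As j \<and> \<tau> j (\<sigma> e) = \<tau> i e) \<and> node_equiv (case_sum id id i) (case_sum id id j) \<sigma>"
    proof (rule opposite_equivalent[where A = "lb y"])
      show "finite (C <+> D)" "C <+> D \<noteq> {}" using finC finD False by auto
      show "\<And>i. i \<in> C <+> D \<Longrightarrow> \<epsilon> i \<noteq> 0" by (auto simp: \<epsilon>_def)
      show "par (lb y) ` edges (lb y) \<subseteq> edges (lb y)" by (rule etreesD(3)[OF lb_etrees])
      fix i assume i: "i \<in> C <+> D"
      have "As i \<subseteq> edges (lb (case_sum id id i)) \<and> par (lb (case_sum id id i)) ` As i \<subseteq> As i \<and>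
        etree_isomorphism (lb (case_sum id id i)\<lparr>edges := As i\<rparr>) (lb y) (\<tau> i)"
      proof (cases i)
        case (Inl c)
        then have c: "c \<in> ch x" using i less.prems(1) by auto
        show ?thesis
          using edges_ch[OF c] par_ch[OF c] iso induced[OF c]
          by (simp add: Inl As_def \<tau>_def etree_isomorphism_def induced_substructure_def)
      next
        case (Inr d)
        then have d: "d \<in> ch y" using i less.prems(2) by auto
        show ?thesis
          using edges_ch[OF d] par_ch[OF d] induced[OF d]
          by (simp add: Inr As_def \<tau>_def etree_isomorphism_def induced_substructure_def)
      qed
      then show "As i \<subseteq> edges (lb (case_sum id id i))"
        "par (lb (case_sum id id i)) ` As i \<subseteq> As i"
        "etree_isomorphism (lb (case_sum id id i)\<lparr>edges := As i\<rparr>) (lb y) (\<tau> i)"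
        by blast+
    next
      fix t :: "(nat, 's) etree" and \<alpha> s assume "t \<in> etrees k \<Sigma>" "embedding (lb y) t \<alpha>"
      from less.prems(3)[OF this, of s]
      show "(\<Sum>i\<in>C <+> D. \<epsilon> i * (\<Sum>\<beta>\<in>extensions (As i) (lb (case_sum id id i)) t (\<alpha> \<circ> \<tau> i).
          hom_count ch lb t s (case_sum id id i) \<beta>)) = 0"
        using finC finD by (simp add: sum.Plus \<epsilon>_def As_def \<tau>_def sum_negf)
    qed
    then obtain i j \<rho> where ij: "i \<in> C <+> D" "j \<in> C <+> D" "\<epsilon> i * \<epsilon> j < 0"
      "\<forall>e\<in>As i. \<rho> e \<in> As j \<and> \<tau> j (\<rho> e) = \<tau> i e"
      "node_equiv (case_sum id id i) (case_sum id id j) \<rho>" by blast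
    have "\<exists>c\<in>C. \<exists>d\<in>D. \<exists>\<sigma>'. node_equiv c d \<sigma>' \<and> (\<forall>e\<in>edges (lb x). \<sigma>' e = \<sigma> e)"
    proof (cases i)
      case (Inl c)
      then obtain d where "j = Inr d" using ij(2,3) by (auto simp: \<epsilon>_def)
      then show ?thesis using ij Inl by (auto simp: As_def \<tau>_def)
    next
      case (Inr d)
      then obtain c where j: "j = Inl c" using ij(2,3) by (auto simp: \<epsilon>_def)
      have c: "c \<in> C" "c \<in> ch x" and d: "d \<in> D" "d \<in> ch y" using ij j Inr less.prems by auto
      have equiv: "node_equiv d c \<rho>" using ij(5) j Inr by simp
      \<comment> \<open>The pair came in reverse order. On the label of \<open>y\<close>, \<rho> is
        a right inverse of \<sigma>, so inverting \<rho> gives an extension of \<sigma>.\<close>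
      have \<rho>: "\<rho> e \<in> edges (lb x)" "\<sigma> (\<rho> e) = e" if "e \<in> edges (lb y)" for e
        using ij(4) that j Inr by (auto simp: As_def \<tau>_def)
      have "inv_into (edges (lb d)) \<rho> e = \<sigma> e" if e: "e \<in> edges (lb x)" for e
      proof -
        have \<sigma>e: "\<sigma> e \<in> edges (lb y)" using iso e by (auto simp: etree_isomorphism_def bij_betw_def)
        have "inj_on \<sigma> (edges (lb x))" using iso by (simp add: etree_isomorphism_def bij_betw_def)
        then have "\<rho> (\<sigma> e) = e" using \<rho>[OF \<sigma>e] e by (simp add: inj_on_eq_iff)
        moreover have "inj_on \<rho> (edges (lb d))"
          using equiv by (simp add: node_equiv_def etree_isomorphism_def bij_betw_def)
        moreover have "\<sigma> e \<in> edges (lb d)" using \<sigma>e edges_ch[OF d(2)] by blast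
        ultimately show ?thesis by (metis inv_into_f_f)
      qed
      then show ?thesis using node_equiv_sym[OF equiv] c(1) d(1) by blast
    qed
    then obtain c d \<sigma>\<^sub>c where cd: "c \<in> C" "d \<in> D" "node_equiv c d \<sigma>\<^sub>c" "\<And>e. e \<in> edges (lb x) \<Longrightarrow> \<sigma>\<^sub>c e = \<sigma> e"
      by blast
    have "\<exists>\<pi> \<sigma>'. bij_betw \<pi> (C - {c}) (D - {d}) \<and>
      (\<forall>c\<in>C - {c}. node_equiv c (\<pi> c) (\<sigma>' c) \<and> (\<forall>e\<in>edges (lb x). \<sigma>' c e = \<sigma> e))"
    proof (rule less.hyps)
      show "card (C - {c}) < card C" using finC cd(1) by (rule card_Diff1_less)
      show "C - {c} \<subseteq> ch x" "D - {d} \<subseteq> ch y" using less.prems by auto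
      fix t :: "(nat, 's) etree" and \<alpha> s assume t: "t \<in> etrees k \<Sigma>" "embedding (lb y) t \<alpha>"
      have "c \<in> ch x" using cd(1) less.prems(1) by blast
      from sum_extensions_equiv[OF cd(3) this iso cd(4) t(1)] less.prems(3)[OF t, of s]
      show "(\<Sum>c\<in>C - {c}. \<Sum>\<beta>\<in>extensions (edges (lb x)) (lb c) t (\<alpha> \<circ> \<sigma>). hom_count ch lb t s c \<beta>) =
          (\<Sum>d\<in>D - {d}. \<Sum>\<beta>\<in>extensions (edges (lb y)) (lb d) t \<alpha>. hom_count ch lb t s d \<beta>)"
        using cd(1,2) finC finD by (simp add: sum_diff1)
    qed
    then obtain \<pi> \<sigma>' where \<pi>: "bij_betw \<pi> (C - {c}) (D - {d})"
      "\<And>c'. c' \<in> C - {c} \<Longrightarrow> node_equiv c' (\<pi> c') (\<sigma>' c') \<and> (\<forall>e\<in>edges (lb x). \<sigma>' c' e = \<sigma> e)"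
      by blast
    have "bij_betw (\<pi>(c := d)) (insert c (C - {c})) (insert d (D - {d}))"
      using \<pi>(1) by (auto simp: bij_betw_def inj_on_def fun_upd_image)
    then have "bij_betw (\<pi>(c := d)) C D" using cd(1,2) by (simp add: insert_absorb)
    then show ?thesis
      using \<pi>(2) cd(3,4) by (intro exI[of _ "\<pi>(c := d)"] exI[of _ "\<sigma>'(c := \<sigma>\<^sub>c)"]) auto
  qed
qed

text \<open>The shape \<open>Shape [s]\<close>, a root with one child, turns the product into the
  bare sum over the children.\<close>

lemma children_matching:
  assumes equiv: "node_equiv x y \<sigma>"
  shows "\<exists>\<pi> \<sigma>'. bij_betw \<pi> (ch x) (ch y) \<and>
    (\<forall>c\<in>ch x. node_equiv c (\<pi> c) (\<sigma>' c) \<and> (\<forall>e\<in>edges (lb x). \<sigma>' c e = \<sigma> e))"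
proof (rule matching_of_equal_sums[OF _ order_refl order_refl])
  show iso: "etree_isomorphism (lb x) (lb y) \<sigma>" using equiv by (simp add: node_equiv_def)
  fix t :: "(nat, 's) etree" and \<alpha> s assume t: "t \<in> etrees k \<Sigma>" and \<alpha>: "embedding (lb y) t \<alpha>"
  let ?\<alpha> = "restrict \<alpha> (edges (lb y))"
  have "?\<alpha> \<in> embeddings (lb y) t" using \<alpha> etreesD(3)[OF lb_etrees] by (rule restrict_in_embeddings)
  then have "hom_count ch lb t (Shape [s]) x (?\<alpha> \<circ> \<sigma>) = hom_count ch lb t (Shape [s]) y ?\<alpha>"
    using equiv t by (simp only: node_equiv_def)
  moreover have "hom_count ch lb t (Shape [s]) x (?\<alpha> \<circ> \<sigma>) = hom_count ch lb t (Shape [s]) x (\<alpha> \<circ> \<sigma>)"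
    using iso by (intro hom_count_cong) (auto simp: etree_isomorphism_def bij_betw_def)
  moreover have "hom_count ch lb t (Shape [s]) y ?\<alpha> = hom_count ch lb t (Shape [s]) y \<alpha>"
    by (intro hom_count_cong) simp
  ultimately show "(\<Sum>c\<in>ch x. \<Sum>\<beta>\<in>extensions (edges (lb x)) (lb c) t (\<alpha> \<circ> \<sigma>). hom_count ch lb t s c \<beta>) =
      (\<Sum>d\<in>ch y. \<Sum>\<beta>\<in>extensions (edges (lb y)) (lb d) t \<alpha>. hom_count ch lb t s d \<beta>)"
    by simp
qed

end

section \<open>Two patterns as one system\<close>

text \<open>Moves the edges of either pattern into the common type \<open>'e + 'f\<close>. The same
  injection serves all nodes, so inclusions of labels remain inclusions.\<close>

definition relabel :: "('e \<Rightarrow> 'f) \<Rightarrow> ('f \<Rightarrow> 'e) \<Rightarrow> ('e, 's) etree \<Rightarrow> ('f, 's) etree" where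
  "relabel f g t = \<lparr>edges = f ` edges t, lab = lab t \<circ> g, par = f \<circ> par t \<circ> g\<rparr>"

lemma relabel_isomorphism:
  assumes "\<And>e. g (f e) = e"
  shows "etree_isomorphism t (relabel f g t) f" "etree_isomorphism (relabel f g t) t g"
  using assms
  by (auto simp: etree_isomorphism_def relabel_def bij_betw_def inj_on_def image_iff) metis+

lemma relabel_in_etrees:
  "t \<in> etrees k \<Sigma> \<Longrightarrow> (\<And>e. g (f e) = e) \<Longrightarrow> relabel f g t \<in> etrees k \<Sigma>"
  by (rule etree_isomorphism_etrees[OF relabel_isomorphism(1)])

lemma induced_substructure_relabel:
  assumes "\<And>e. g (f e) = e" "induced_substructure A B"
  shows "induced_substructure (relabel f g A) (relabel f g B)"
  using assms by (auto simp: induced_substructure_def relabel_def)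

definition empty_etree :: "('e, 's) etree" where
  "empty_etree = \<lparr>edges = {}, lab = (\<lambda>_. undefined), par = (\<lambda>e. e)\<rparr>"

lemma empty_etree_in_etrees: "empty_etree \<in> etrees k \<Sigma>"
  by (simp add: empty_etree_def etrees_def)

lemma etree_isomorphism_comp:
  assumes "etree_isomorphism A B f" "etree_isomorphism B C g"
  shows "etree_isomorphism A C (g \<circ> f)"
  using assms by (auto simp: etree_isomorphism_def dest: bij_betwE intro: bij_betw_trans)

fun sum_children :: "('x, 'e, 's) pattern \<Rightarrow> ('y, 'f, 's) pattern \<Rightarrow> 'x + 'y \<Rightarrow> ('x + 'y) set" where
  "sum_children \<Phi> \<Psi> (Inl x) = Inl ` (arcs \<Phi> `` {x})"
| "sum_children \<Phi> \<Psi> (Inr y) = Inr ` (arcs \<Psi> `` {y})"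

text \<open>The empty label outside the nodes makes the locale assumptions hold for all \<open>'x + 'y\<close>.\<close>

fun sum_label :: "('x, 'e, 's) pattern \<Rightarrow> ('y, 'f, 's) pattern \<Rightarrow> 'x + 'y \<Rightarrow> ('e + 'f, 's) etree" where
  "sum_label \<Phi> \<Psi> (Inl x) = (if x \<in> nodes \<Phi> then relabel Inl projl (label \<Phi> x) else empty_etree)"
| "sum_label \<Phi> \<Psi> (Inr y) = (if y \<in> nodes \<Psi> then relabel Inr projr (label \<Psi> y) else empty_etree)"

lemma patternsD:
  fixes \<Phi> :: "('x, 'e, 's) pattern"
  assumes "\<Phi> \<in> patterns k \<Sigma>"
  shows "finite_rooted_tree \<Phi>" "finite (nodes \<Phi>)" "root \<Phi> \<in> nodes \<Phi>" "arcs \<Phi> \<subseteq> nodes \<Phi> \<times> nodes \<Phi>"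
    "\<And>x. x \<in> nodes \<Phi> \<Longrightarrow> label \<Phi> x \<in> etrees k \<Sigma>" "edges (label \<Phi> (root \<Phi>)) = {}"
    "\<And>x y. (x, y) \<in> arcs \<Phi> \<Longrightarrow> induced_substructure (label \<Phi> x) (label \<Phi> y)"
  using assms by (auto simp: patterns_def finite_rooted_tree_def)

lemma pattern_system_sum:
  assumes "\<Phi> \<in> patterns k \<Sigma>" "\<Psi> \<in> patterns k \<Sigma>"
  shows "pattern_system (sum_children \<Phi> \<Psi>) (sum_label \<Phi> \<Psi>) k \<Sigma>"
proof
  note \<Phi> = patternsD[OF assms(1)] and \<Psi> = patternsD[OF assms(2)]
  have "finite (arcs \<Phi>)" "finite (arcs \<Psi>)"
    using \<Phi>(2,4) \<Psi>(2,4) by (auto intro: finite_subset)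
  then show "finite (sum_children \<Phi> \<Psi> z)" for z
    by (cases z) (simp_all add: finite_Image)
  show "sum_label \<Phi> \<Psi> z \<in> etrees k \<Sigma>" for z
    by (cases z) (simp_all add: empty_etree_in_etrees relabel_in_etrees \<Phi>(5) \<Psi>(5))
  show "induced_substructure (sum_label \<Phi> \<Psi> z) (sum_label \<Phi> \<Psi> z')" if "z' \<in> sum_children \<Phi> \<Psi> z" for z z'
    using that \<Phi>(4,7) \<Psi>(4,7) by (cases z) (auto intro!: induced_substructure_relabel)
qed

text \<open>Links the actual output tree with the abstract counts; \<iota>, \<open>f\<close> and
  \<open>g\<close> are left general to cover both injections into the sum.\<close>

lemma tree_count_pattern_fun:
  assumes \<Phi>: "\<Phi> \<in> patterns k \<Sigma>" and t: "t \<in> etrees k \<Sigma>" and x: "x \<in> nodes \<Phi>" and \<alpha>: "\<alpha> \<in> embeddings (label \<Phi> x) t"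
    and \<iota>: "inj \<iota>" "\<And>x. x \<in> nodes \<Phi> \<Longrightarrow> ch (\<iota> x) = \<iota> ` (arcs \<Phi> `` {x})"
    and gf: "\<And>e. g (f e) = e" and lb: "\<And>x. x \<in> nodes \<Phi> \<Longrightarrow> lb (\<iota> x) = relabel f g (label \<Phi> x)"
  shows "tree_count (arcs (pattern_fun \<Phi> t)) s (x, \<alpha>) = hom_count ch lb t s (\<iota> x) (\<alpha> \<circ> g)"
  using x \<alpha>
proof (induction s arbitrary: x \<alpha>)
  case (Shape ss)
  note P = patternsD[OF \<Phi>]
  let ?E = "\<lambda>y. extensions (edges (label \<Phi> x)) (label \<Phi> y) t \<alpha>"
  let ?E' = "\<lambda>y. extensions (edges (lb (\<iota> x))) (lb (\<iota> y)) t (\<alpha> \<circ> g)"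
  have children: "arcs (pattern_fun \<Phi> t) `` {(x, \<alpha>)} = Sigma (arcs \<Phi> `` {x}) ?E"
    using Shape.prems(2) by (auto simp: pattern_fun_def extensions_def)
  have fin: "finite (arcs \<Phi> `` {x})"
    using P(2,4) by (auto intro: finite_subset)
  have "(\<Sum>z\<in>arcs (pattern_fun \<Phi> t) `` {(x, \<alpha>)}. tree_count (arcs (pattern_fun \<Phi> t)) s z) =
      (\<Sum>z\<in>ch (\<iota> x). \<Sum>\<beta>\<in>extensions (edges (lb (\<iota> x))) (lb z) t (\<alpha> \<circ> g). hom_count ch lb t s z \<beta>)"
    if s: "s \<in> set ss" for s
  proof -
    have inner: "(\<Sum>\<beta>\<in>?E y. hom_count ch lb t s (\<iota> y) (\<beta> \<circ> g)) = (\<Sum>\<beta>\<in>?E' y. hom_count ch lb t s (\<iota> y) \<beta>)"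
      if y: "y \<in> arcs \<Phi> `` {x}" for y
    proof -
      have yN: "y \<in> nodes \<Phi>" using y P(4) by auto
      have sub: "edges (label \<Phi> x) \<subseteq> edges (label \<Phi> y)"
        using y P(7) by (auto simp: induced_substructure_def)
      have edges_x: "edges (lb (\<iota> x)) = f ` edges (label \<Phi> x)"
        using lb[OF Shape.prems(1)] by (simp add: relabel_def)
      have edges_y: "edges (lb (\<iota> y)) = f ` edges (label \<Phi> y)"
        using lb[OF yN] by (simp add: relabel_def)
      have bij: "bij_betw (\<lambda>\<beta>. restrict (\<beta> \<circ> f) (edges (label \<Phi> y))) (?E' y) (?E y)"
        unfolding lb[OF yN] edges_x
        by (rule bij_betw_extensions_source[OF relabel_isomorphism(1)[where f = f and g = g, OF gf] etreesD(3)[OF P(5)[OF yN]] sub])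
          (simp add: gf)
      have "hom_count ch lb t s (\<iota> y) (restrict (\<beta> \<circ> f) (edges (label \<Phi> y)) \<circ> g) =
          hom_count ch lb t s (\<iota> y) \<beta>" for \<beta>
        by (rule hom_count_cong) (auto simp: edges_y gf)
      then show ?thesis using sum.reindex_bij_betw[OF bij, of "\<lambda>\<beta>. hom_count ch lb t s (\<iota> y) (\<beta> \<circ> g)"] by simp
    qed
    have "(\<Sum>z\<in>arcs (pattern_fun \<Phi> t) `` {(x, \<alpha>)}. tree_count (arcs (pattern_fun \<Phi> t)) s z) =
        (\<Sum>z\<in>Sigma (arcs \<Phi> `` {x}) ?E. hom_count ch lb t s (\<iota> (fst z)) (snd z \<circ> g))"
      unfolding children
    proof (rule sum.cong[OF refl])
      fix z assume z: "z \<in> Sigma (arcs \<Phi> `` {x}) ?E"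
      then have "fst z \<in> nodes \<Phi>" "snd z \<in> embeddings (label \<Phi> (fst z)) t"
        using P(4) by (auto simp: extensions_def)
      from Shape.IH[OF s this]
      show "tree_count (arcs (pattern_fun \<Phi> t)) s z = hom_count ch lb t s (\<iota> (fst z)) (snd z \<circ> g)"
        by (simp only: prod.collapse)
    qed
    also have "\<dots> = (\<Sum>y\<in>arcs \<Phi> `` {x}. \<Sum>\<beta>\<in>?E y. hom_count ch lb t s (\<iota> y) (\<beta> \<circ> g))"
    proof -
      have "finite (?E y)" if "y \<in> arcs \<Phi> `` {x}" for y
        using that P(4) by (intro finite_extensions etreesD(1)[OF P(5)] etreesD(1)[OF t]) auto
      then show ?thesis using fin by (simp add: sum.Sigma split_beta)
    qed
    also have "\<dots> = (\<Sum>y\<in>arcs \<Phi> `` {x}. \<Sum>\<beta>\<in>?E' y. hom_count ch lb t s (\<iota> y) \<beta>)"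
      using inner by (intro sum.cong) auto
    also have "\<dots> = (\<Sum>z\<in>ch (\<iota> x). \<Sum>\<beta>\<in>extensions (edges (lb (\<iota> x))) (lb z) t (\<alpha> \<circ> g). hom_count ch lb t s z \<beta>)"
      unfolding \<iota>(2)[OF Shape.prems(1)] using \<iota>(1) by (subst sum.reindex) (auto intro: inj_on_subset)
    finally show ?thesis .
  qed
  then show ?case
    by (auto simp only: hom_count.simps tree_count.simps intro!: arg_cong[where f = prod_list] map_cong)
qed

section \<open>Recursion along a rooted tree\<close>

inductive tree_rec :: "('x, 'm) rtree_scheme \<Rightarrow> 'a \<Rightarrow> ('a \<Rightarrow> 'x \<Rightarrow> 'x \<Rightarrow> 'a) \<Rightarrow> 'x \<Rightarrow> 'a \<Rightarrow> bool"
  for T a f where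
  root: "tree_rec T a f (root T) a"
| step: "tree_rec T a f x v \<Longrightarrow> (x, y) \<in> arcs T \<Longrightarrow> tree_rec T a f y (f v x y)"

lemma finite_rooted_treeD:
  assumes "finite_rooted_tree T"
  shows "root T \<in> nodes T" "arcs T \<subseteq> nodes T \<times> nodes T" "(x, root T) \<notin> arcs T"
    "(x, y) \<in> arcs T \<Longrightarrow> (x', y) \<in> arcs T \<Longrightarrow> x = x'"
    "y \<in> nodes T \<Longrightarrow> y \<noteq> root T \<Longrightarrow> \<exists>x. (x, y) \<in> arcs T"
proof -
  show "(x, y) \<in> arcs T \<Longrightarrow> (x', y) \<in> arcs T \<Longrightarrow> x = x'"
    using assms unfolding finite_rooted_tree_def by (metis DiffI SigmaD2 singletonD subsetD)
qed (use assms in \<open>auto simp: finite_rooted_tree_def\<close>)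

lemma finite_rooted_tree_induct [consumes 2, case_names root arc]:
  assumes T: "finite_rooted_tree T" and x: "x \<in> nodes T"
    and P: "P (root T)" "\<And>x y. (x, y) \<in> arcs T \<Longrightarrow> P x \<Longrightarrow> P y"
  shows "P x"
proof -
  have "(root T, x) \<in> (arcs T)\<^sup>*" using T x by (simp add: finite_rooted_tree_def)
  then show ?thesis by (induction rule: rtrancl_induct) (use P in auto)
qed

text \<open>Recursion from the root along arcs: the value at a node is unique because parents are,
  and exists because every node is reachable.\<close>

lemma tree_recursion:
  assumes T: "finite_rooted_tree T"
  obtains G where "G (root T) = a" "\<And>x y. (x, y) \<in> arcs T \<Longrightarrow> G y = f (G x) x y"
proof
  let ?R = "tree_rec T a f"
  have unique: "?R x v \<Longrightarrow> ?R x v' \<Longrightarrow> v' = v" for x v v'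
  proof (induction arbitrary: v' rule: tree_rec.induct)
    case root
    then show ?case using finite_rooted_treeD(3)[OF T] by (auto elim: tree_rec.cases)
  next
    case (step x v y)
    from step.prems show ?case
    proof cases
      case root
      then show ?thesis using step.hyps(2) finite_rooted_treeD(3)[OF T] by blast
    next
      case (step x' u)
      then show ?thesis using step.hyps(2) step.IH finite_rooted_treeD(4)[OF T] by metis
    qed
  qed
  have exist: "\<exists>v. ?R x v" if "x \<in> nodes T" for x
    using T that by (induction rule: finite_rooted_tree_induct) (blast intro: tree_rec.intros)+
  have THE_eq: "(THE v. ?R x v) = v" if "?R x v" for x v
    using that unique by blast
  show "(THE v. ?R (root T) v) = a" by (intro THE_eq tree_rec.root)
  fix x y assume arc: "(x, y) \<in> arcs T"
  then obtain v where v: "?R x v" using exist finite_rooted_treeD(2)[OF T] by blast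
  from THE_eq[OF v] THE_eq[OF tree_rec.step[OF v arc]]
  show "(THE v. ?R y v) = f (THE v. ?R x v) x y" by simp
qed

text \<open>Local bijections glue. For injectivity, equal images have equal parents in
  \<open>U\<close>, so by induction the parents in \<open>T\<close> agree, and the local bijection
  there decides.\<close>

lemma rtree_isomorphismI:
  assumes T: "finite_rooted_tree T" and U: "finite_rooted_tree U" and root_eq: "g (root T) = root U"
    and bij: "\<And>x. x \<in> nodes T \<Longrightarrow> bij_betw g (arcs T `` {x}) (arcs U `` {g x})"
  shows "rtree_isomorphism T U g"
proof -
  note T' = finite_rooted_treeD[OF T] and U' = finite_rooted_treeD[OF U]
  have hom: "(g x, g y) \<in> arcs U" if "(x, y) \<in> arcs T" for x y
    using bij[of x] that T'(2) by (auto simp: bij_betw_def)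
  have in_U: "g x \<in> nodes U" if "x \<in> nodes T" for x
  proof -
    have step: "g y \<in> nodes U" if "(x, y) \<in> arcs T" for x y
      using hom[OF that] U'(2) by blast
    show ?thesis
      using T that by (induction rule: finite_rooted_tree_induct) (use root_eq U'(1) step in auto)
  qed
  have inj: "\<forall>y\<in>nodes T. g y = g x \<longrightarrow> y = x" if "x \<in> nodes T" for x
    using T that
  proof (induction rule: finite_rooted_tree_induct)
    case root
    show ?case
    proof (intro ballI impI)
      fix y assume y: "y \<in> nodes T" "g y = g (root T)"
      show "y = root T"
      proof (rule ccontr)
        assume "y \<noteq> root T"
        then obtain x where "(x, y) \<in> arcs T" using T'(5) y(1) by blast
        then show False using hom y(2) root_eq U'(3) by metis
      qed
    qed
  next
    case (arc x c)
    show ?case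
    proof (intro ballI impI)
      fix y assume y: "y \<in> nodes T" "g y = g c"
      have gc: "(g x, g c) \<in> arcs U" by (rule hom[OF arc.hyps])
      then have "y \<noteq> root T" using y(2) root_eq U'(3) by metis
      then obtain x' where x': "(x', y) \<in> arcs T" using T'(5) y(1) by blast
      then have "(g x', g c) \<in> arcs U" using hom y(2) by metis
      then have "g x' = g x" using U'(4) gc by blast
      then have "x' = x" using arc.IH x' T'(2) by blast
      moreover have "inj_on g (arcs T `` {x})"
        using bij[of x] arc.hyps T'(2) by (auto simp: bij_betw_def)
      ultimately show "y = c" using x' arc.hyps y(2) by (auto dest: inj_onD)
    qed
  qed
  have surj: "\<exists>x\<in>nodes T. u = g x" if "u \<in> nodes U" for u
    using U that
  proof (induction rule: finite_rooted_tree_induct)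
    case root
    then show ?case using root_eq T'(1) by metis
  next
    case (arc u v)
    then obtain x where x: "x \<in> nodes T" "u = g x" by blast
    then have "v \<in> g ` (arcs T `` {x})" using bij[of x] arc.hyps by (auto simp: bij_betw_def)
    then show ?case using T'(2) by blast
  qed
  have "bij_betw g (nodes T) (nodes U)"
    using inj surj in_U unfolding bij_betw_def inj_on_def by blast
  moreover have "(x, y) \<in> arcs T" if x: "x \<in> nodes T" and y: "y \<in> nodes T" and "(g x, g y) \<in> arcs U" for x y
  proof -
    have "g y \<in> g ` (arcs T `` {x})" using bij[OF x] that(3) by (auto simp: bij_betw_def)
    then obtain y' where y': "(x, y') \<in> arcs T" "g y' = g y" by auto
    then have "y' \<in> nodes T" using T'(2) by auto
    with inj[OF y] y'(2) have "y' = y" by simp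
    then show ?thesis using y'(1) by simp
  qed
  ultimately show ?thesis using root_eq hom by (auto simp: rtree_isomorphism_def)
qed

section \<open>From equal counts to a pattern isomorphism\<close>

theorem theorem5p6:
  fixes \<Sigma> :: "'s set" and k :: nat
    and \<Phi>\<^sub>1 :: "('x, 'e, 's) pattern" and \<Phi>\<^sub>2 :: "('y, 'f, 's) pattern"
  assumes "finite \<Sigma>"
    and "\<Phi>\<^sub>1 \<in> patterns k \<Sigma>" and "\<Phi>\<^sub>2 \<in> patterns k \<Sigma>"
    and "\<not> pattern_isomorphic \<Phi>\<^sub>1 \<Phi>\<^sub>2"
  shows "\<exists>t :: (nat, 's) etree. t \<in> etrees k \<Sigma> \<and>
    \<not> rtree_isomorphic (pattern_fun \<Phi>\<^sub>1 t) (pattern_fun \<Phi>\<^sub>2 t)"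
proof (rule ccontr)
  assume contra: "\<not> ?thesis"
  note P1 = patternsD[OF assms(2)] and P2 = patternsD[OF assms(3)]
  let ?ch = "sum_children \<Phi>\<^sub>1 \<Phi>\<^sub>2" and ?lb = "sum_label \<Phi>\<^sub>1 \<Phi>\<^sub>2"
  interpret pattern_system ?ch ?lb k \<Sigma>
    using assms(2,3) by (rule pattern_system_sum)
  \<comment> \<open>The root labels are empty, so any map is an isomorphism between them, every
    embedding gives the same count, and that count is the one at the root of the output.\<close>
  have root_equiv: "node_equiv (Inl (root \<Phi>\<^sub>1)) (Inr (root \<Phi>\<^sub>2)) id"
    unfolding node_equiv_def
  proof (intro conjI ballI allI)
    have empty: "edges (?lb (Inl (root \<Phi>\<^sub>1))) = {}" "edges (?lb (Inr (root \<Phi>\<^sub>2))) = {}"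
      using P1(6) P2(6) by (simp_all add: relabel_def empty_etree_def)
    then show "etree_isomorphism (?lb (Inl (root \<Phi>\<^sub>1))) (?lb (Inr (root \<Phi>\<^sub>2))) id"
      by (simp add: etree_isomorphism_def)
    fix t :: "(nat, 's) etree" and \<beta> s assume t: "t \<in> etrees k \<Sigma>"
    let ?u = "\<lambda>_. undefined"
    have u: "?u \<in> embeddings (label \<Phi>\<^sub>1 (root \<Phi>\<^sub>1)) t" "?u \<in> embeddings (label \<Phi>\<^sub>2 (root \<Phi>\<^sub>2)) t"
      using P1(6) P2(6) by (simp_all add: embeddings_def embedding_def)
    obtain g where g: "rtree_isomorphism (pattern_fun \<Phi>\<^sub>1 t) (pattern_fun \<Phi>\<^sub>2 t) g"
      using contra t by (auto simp: rtree_isomorphic_def)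
    then have "g (root \<Phi>\<^sub>1, ?u) = (root \<Phi>\<^sub>2, ?u)"
      by (simp add: rtree_isomorphism_def pattern_fun_def)
    moreover have "(root \<Phi>\<^sub>1, ?u) \<in> nodes (pattern_fun \<Phi>\<^sub>1 t)"
      using u P1(3) by (simp add: pattern_fun_def)
    ultimately have "tree_count (arcs (pattern_fun \<Phi>\<^sub>1 t)) s (root \<Phi>\<^sub>1, ?u) =
        tree_count (arcs (pattern_fun \<Phi>\<^sub>2 t)) s (root \<Phi>\<^sub>2, ?u)"
      using rtree_isomorphism_tree_count[OF g finite_rooted_tree_pattern_fun[OF assms(2) t]
          finite_rooted_tree_pattern_fun[OF assms(3) t]] by metis
    moreover have "tree_count (arcs (pattern_fun \<Phi>\<^sub>1 t)) s (root \<Phi>\<^sub>1, ?u) =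
        hom_count ?ch ?lb t s (Inl (root \<Phi>\<^sub>1)) (?u \<circ> projl)"
      by (rule tree_count_pattern_fun[OF assms(2) t P1(3) u(1), where f = Inl]) simp_all
    moreover have "tree_count (arcs (pattern_fun \<Phi>\<^sub>2 t)) s (root \<Phi>\<^sub>2, ?u) =
        hom_count ?ch ?lb t s (Inr (root \<Phi>\<^sub>2)) (?u \<circ> projr)"
      by (rule tree_count_pattern_fun[OF assms(3) t P2(3) u(2), where f = Inr]) simp_all
    ultimately show "hom_count ?ch ?lb t s (Inl (root \<Phi>\<^sub>1)) (\<beta> \<circ> id) = hom_count ?ch ?lb t s (Inr (root \<Phi>\<^sub>2)) \<beta>"
      using hom_count_cong[of ?lb "Inl (root \<Phi>\<^sub>1)" "\<beta> \<circ> id" "?u \<circ> projl" ?ch t s]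
        hom_count_cong[of ?lb "Inr (root \<Phi>\<^sub>2)" \<beta> "?u \<circ> projr" ?ch t s] empty by simp
  qed

  \<comment> \<open>\<open>v\<close> is the partner of \<open>x\<close> with its isomorphism;
    \<open>p\<close> is a matching of the children with isomorphisms that extend it.\<close>
  define M where "M x v p \<longleftrightarrow> bij_betw (fst p) (?ch (Inl x)) (?ch (Inr (fst v))) \<and>
    (\<forall>c\<in>?ch (Inl x). node_equiv c (fst p c) (snd p c) \<and> (\<forall>e\<in>edges (?lb (Inl x)). snd p c e = snd v e))"
    for x :: 'x and v :: "'y \<times> ('e + 'f \<Rightarrow> 'e + 'f)" and p
  define m where "m x v = (SOME p. M x v p)" for x v
  have m: "M x v (m x v)" if equiv: "node_equiv (Inl x) (Inr (fst v)) (snd v)" for x v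
  proof -
    obtain \<pi> \<sigma>' where "M x v (\<pi>, \<sigma>')" using children_matching[OF equiv] unfolding M_def by auto
    then show ?thesis unfolding m_def by (rule someI)
  qed
  \<comment> \<open>Partner and isomorphism are constructed by one recursion, because the matching
    of the children depends on both.\<close>
  obtain G where G: "G (root \<Phi>\<^sub>1) = (root \<Phi>\<^sub>2, id)"
    "\<And>x c. (x, c) \<in> arcs \<Phi>\<^sub>1 \<Longrightarrow> G c = (projr (fst (m x (G x)) (Inl c)), snd (m x (G x)) (Inl c))"
    using tree_recursion[OF P1(1), of "(root \<Phi>\<^sub>2, id)"
        "\<lambda>v x c. (projr (fst (m x v) (Inl c)), snd (m x v) (Inl c))"] by blast
  define g where "g x = fst (G x)" for x
  have child: "Inr (g c) = fst (m x (G x)) (Inl c) \<and> (g x, g c) \<in> arcs \<Phi>\<^sub>2 \<and>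
      node_equiv (Inl c) (Inr (g c)) (snd (G c)) \<and> (\<forall>e\<in>edges (?lb (Inl x)). snd (G c) e = snd (G x) e)"
    if arc: "(x, c) \<in> arcs \<Phi>\<^sub>1" and equiv: "node_equiv (Inl x) (Inr (g x)) (snd (G x))" for x c
  proof -
    have M: "M x (G x) (m x (G x))" using m equiv by (simp add: g_def)
    have c: "Inl c \<in> ?ch (Inl x)" using arc by simp
    then have "fst (m x (G x)) (Inl c) \<in> ?ch (Inr (g x))"
      using M unfolding M_def g_def by (blast dest: bij_betwE)
    then obtain d where d: "fst (m x (G x)) (Inl c) = Inr d" "(g x, d) \<in> arcs \<Phi>\<^sub>2" by auto
    have gc: "g c = d" "snd (G c) = snd (m x (G x)) (Inl c)"
      using G(2)[OF arc] d by (simp_all add: g_def)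
    have *: "node_equiv (Inl c) (fst (m x (G x)) (Inl c)) (snd (m x (G x)) (Inl c)) \<and>
        (\<forall>e\<in>edges (?lb (Inl x)). snd (m x (G x)) (Inl c) e = snd (G x) e)"
      using M c unfolding M_def by blast
    show ?thesis unfolding gc d(1) using d(2) *[unfolded d(1)] by blast
  qed
  have equiv: "node_equiv (Inl x) (Inr (g x)) (snd (G x))" if "x \<in> nodes \<Phi>\<^sub>1" for x
    using P1(1) that
  proof (induction rule: finite_rooted_tree_induct)
    case root
    show ?case using root_equiv by (simp only: g_def G(1) fst_conv snd_conv)
  next
    case (arc x c)
    then show ?case using child by blast
  qed
  have iso: "rtree_isomorphism \<Phi>\<^sub>1 \<Phi>\<^sub>2 g"
  proof (rule rtree_isomorphismI[OF P1(1) P2(1)])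
    show "g (root \<Phi>\<^sub>1) = root \<Phi>\<^sub>2" by (simp add: g_def G(1))
    fix x assume x: "x \<in> nodes \<Phi>\<^sub>1"
    have bij: "bij_betw (fst (m x (G x))) (Inl ` (arcs \<Phi>\<^sub>1 `` {x})) (Inr ` (arcs \<Phi>\<^sub>2 `` {g x}))"
      using m[of x "G x"] equiv[OF x] by (simp add: M_def g_def)
    have eq: "Inr (g c) = fst (m x (G x)) (Inl c)" if "c \<in> arcs \<Phi>\<^sub>1 `` {x}" for c
      using child[OF _ equiv[OF x]] that by blast
    show "bij_betw g (arcs \<Phi>\<^sub>1 `` {x}) (arcs \<Phi>\<^sub>2 `` {g x})"
    proof (rule bij_betw_imageI)
      show "inj_on g (arcs \<Phi>\<^sub>1 `` {x})"
      proof (rule inj_onI)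
        fix c c' assume c: "c \<in> arcs \<Phi>\<^sub>1 `` {x}" "c' \<in> arcs \<Phi>\<^sub>1 `` {x}" "g c = g c'"
        then have "fst (m x (G x)) (Inl c) = fst (m x (G x)) (Inl c')" using eq by metis
        then have "Inl c = (Inl c' :: 'x + 'y)"
          using bij c(1,2) unfolding bij_betw_def by (blast dest: inj_onD)
        then show "c = c'" by simp
      qed
      have "Inr ` g ` (arcs \<Phi>\<^sub>1 `` {x}) = fst (m x (G x)) ` Inl ` (arcs \<Phi>\<^sub>1 `` {x})"
        unfolding image_image using eq by (rule image_cong[OF refl])
      also have "\<dots> = Inr ` (arcs \<Phi>\<^sub>2 `` {g x})" using bij by (simp only: bij_betw_def)
      finally show "g ` (arcs \<Phi>\<^sub>1 `` {x}) = arcs \<Phi>\<^sub>2 `` {g x}"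
        by (simp only: inj_image_eq_iff[OF inj_Inr])
    qed
  qed
  define h where "h x = projr \<circ> snd (G x) \<circ> Inl" for x
  have "etree_isomorphism (label \<Phi>\<^sub>1 x) (label \<Phi>\<^sub>2 (g x)) (h x)" if x: "x \<in> nodes \<Phi>\<^sub>1" for x
  proof -
    have gx: "g x \<in> nodes \<Phi>\<^sub>2" using iso x by (auto simp: rtree_isomorphism_def bij_betw_def)
    have "etree_isomorphism (relabel Inl projl (label \<Phi>\<^sub>1 x)) (relabel Inr projr (label \<Phi>\<^sub>2 (g x))) (snd (G x))"
      using equiv[OF x] x gx by (simp add: node_equiv_def)
    from etree_isomorphism_comp[OF etree_isomorphism_comp[OF relabel_isomorphism(1) this]
        relabel_isomorphism(2)]
    show ?thesis by (simp add: h_def comp_assoc)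
  qed
  moreover have "h y e = h x e" if "(x, y) \<in> arcs \<Phi>\<^sub>1" "e \<in> edges (label \<Phi>\<^sub>1 x)" for x y e
  proof -
    have x: "x \<in> nodes \<Phi>\<^sub>1" using that(1) P1(4) by auto
    have "Inl e \<in> edges (?lb (Inl x))" using x that(2) by (simp add: relabel_def)
    then have "snd (G y) (Inl e) = snd (G x) (Inl e)" using child[OF that(1) equiv[OF x]] by blast
    then show ?thesis by (simp add: h_def)
  qed
  ultimately have "pattern_isomorphic \<Phi>\<^sub>1 \<Phi>\<^sub>2"
    using iso unfolding pattern_isomorphic_def by blast
  then show False using assms(4) by contradiction
qed

end
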